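(* Let $B_w:H(\mathbb{C})\to H(\mathbb{C})$ be a hypercyclic weighted shift defined by $B_wz^n=w_nz^{n-1}$ for $n\ge 1$ and $B_w1=0$. The operator $B_w$ possesses a hypercyclic subspace if and only if there exists an integer $m\ge 1$ such that $$\sup_{n\ge1}\inf_{k\ge 0}\frac{\prod_{\nu=1}^{n}|w_{\nu+k}|}{m^{n+k}}\le 1.$$
   Context: $H(\mathbb{C})$ is the Fréchet space of entire functions with the topology of uniform convergence on compact sets. $w=(w_n)_{n\ge1}$ is a sequence of non-zero scalars, and $B_w$ is a continuous linear operator on $H(\mathbb{C})$. A vector $x$ is hypercyclic for $B_w$ if $\{B_w^nx:n\ge 1\}$ is dense in $H(\mathbb{C})$; $B_w$ is hypercyclic if it has a hypercyclic vector. A hypercyclic subspace for $B_w$ is an infinite-dimensional closed linear subspace of $H(\mathbb{C})$ in which every non-zero vector is hypercyclic for $B_w$. *)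

theory Defs
  imports "HOL-Complex_Analysis.Complex_Analysis" "HOL-Library.Function_Algebras"
begin

definition entire :: "(complex \<Rightarrow> complex) set" where
  "entire = {f. f holomorphic_on UNIV}"

definition entire_topology :: "(complex \<Rightarrow> complex) topology" where
  "entire_topology = topology (\<lambda>U. U \<subseteq> entire \<and>
     (\<forall>f\<in>U. \<exists>K e. compact K \<and> 0 < e \<and>
        (\<forall>g\<in>entire. (\<forall>z\<in>K. dist (g z) (f z) < e) \<longrightarrow> g \<in> U)))"

lemma istopology_entire:
  "istopology (\<lambda>U. U \<subseteq> entire \<and>
     (\<forall>f\<in>U. \<exists>K e. compact K \<and> 0 < e \<and>
        (\<forall>g\<in>entire. (\<forall>z\<in>K. dist (g z) (f z) < e) \<longrightarrow> g \<in> U)))"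
  (is "istopology ?P")
  unfolding istopology_def
proof (intro conjI allI impI)
  fix S T assume S: "?P S" and T: "?P T"
  show "S \<inter> T \<subseteq> entire" using S by blast
  show "\<forall>f\<in>S \<inter> T. \<exists>K e. compact K \<and> 0 < e \<and>
      (\<forall>g\<in>entire. (\<forall>z\<in>K. dist (g z) (f z) < e) \<longrightarrow> g \<in> S \<inter> T)"
  proof
    fix f assume f: "f \<in> S \<inter> T"
    obtain K d where K: "compact K" "0 < d"
      "\<And>g. g \<in> entire \<Longrightarrow> (\<forall>z\<in>K. dist (g z) (f z) < d) \<Longrightarrow> g \<in> S"
      using S f by (meson IntD1)
    obtain L e where L: "compact L" "0 < e"
      "\<And>g. g \<in> entire \<Longrightarrow> (\<forall>z\<in>L. dist (g z) (f z) < e) \<Longrightarrow> g \<in> T"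
      using T f by (meson IntD2)
    show "\<exists>K e. compact K \<and> 0 < e \<and>
        (\<forall>g\<in>entire. (\<forall>z\<in>K. dist (g z) (f z) < e) \<longrightarrow> g \<in> S \<inter> T)"
    proof (intro exI conjI ballI impI)
      show "compact (K \<union> L)" by (rule compact_Un[OF K(1) L(1)])
      show "0 < min d e" using K(2) L(2) by simp
      fix g assume g: "g \<in> entire" "\<forall>z\<in>K \<union> L. dist (g z) (f z) < min d e"
      show "g \<in> S \<inter> T" using K(3)[OF g(1)] L(3)[OF g(1)] g(2) by simp
    qed
  qed
next
  fix \<U> assume U: "\<forall>S\<in>\<U>. ?P S"
  show "\<Union>\<U> \<subseteq> entire" using U by blast
  show "\<forall>f\<in>\<Union>\<U>. \<exists>K e. compact K \<and> 0 < e \<and>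
      (\<forall>g\<in>entire. (\<forall>z\<in>K. dist (g z) (f z) < e) \<longrightarrow> g \<in> \<Union>\<U>)"
  proof
    fix f assume "f \<in> \<Union>\<U>"
    then obtain S where S: "S \<in> \<U>" "f \<in> S" by blast
    then obtain K e where "compact K" "0 < e"
      "\<forall>g\<in>entire. (\<forall>z\<in>K. dist (g z) (f z) < e) \<longrightarrow> g \<in> S"
      using U by meson
    then show "\<exists>K e. compact K \<and> 0 < e \<and>
        (\<forall>g\<in>entire. (\<forall>z\<in>K. dist (g z) (f z) < e) \<longrightarrow> g \<in> \<Union>\<U>)"
      using S(1) by (meson UnionI)
  qed
qed

lemma openin_entire_topology:
  "openin entire_topology U \<longleftrightarrow> U \<subseteq> entire \<and>
     (\<forall>f\<in>U. \<exists>K e. compact K \<and> 0 < e \<and>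
        (\<forall>g\<in>entire. (\<forall>z\<in>K. dist (g z) (f z) < e) \<longrightarrow> g \<in> U))"
  unfolding entire_topology_def by (subst topology_inverse'[OF istopology_entire]) (rule refl)

lemma topspace_entire_topology [simp]: "topspace entire_topology = entire"
proof
  show "topspace entire_topology \<subseteq> entire"
    using openin_entire_topology[of "topspace entire_topology"] by simp
  have "openin entire_topology entire"
    unfolding openin_entire_topology using compact_empty zero_less_one by blast
  then show "entire \<subseteq> topspace entire_topology" by (rule openin_subset)
qed

definition cscale :: "complex \<Rightarrow> (complex \<Rightarrow> complex) \<Rightarrow> complex \<Rightarrow> complex" where
  "cscale c f = (\<lambda>z. c * f z)"

text \<open>Addition and zero of functions are the pointwise ones of
  \<^theory>\<open>HOL-Library.Function_Algebras\<close>.\<close>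

global_interpretation cfun: vector_space cscale
  by unfold_locales (auto simp: cscale_def fun_eq_iff algebra_simps)

text \<open>Operators on the space of entire functions are represented by maps on all functions whose
  values outside \<^const>\<open>entire\<close> are irrelevant; continuity includes that
  \<^const>\<open>entire\<close> is mapped into itself.\<close>

definition continuous_linear_operator ::
    "((complex \<Rightarrow> complex) \<Rightarrow> (complex \<Rightarrow> complex)) \<Rightarrow> bool" where
  "continuous_linear_operator T \<longleftrightarrow>
     continuous_map entire_topology entire_topology T \<and>
     (\<forall>f\<in>entire. \<forall>g\<in>entire. T (f + g) = T f + T g) \<and>
     (\<forall>c. \<forall>f\<in>entire. T (cscale c f) = cscale c (T f))"

text \<open>The weights are indexed from 1; the value \<open>w 0\<close> plays no role. These conditions determine
  \<open>B\<close> on \<^const>\<open>entire\<close>, since the polynomials are dense.\<close>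

definition weighted_shift ::
    "(nat \<Rightarrow> complex) \<Rightarrow> ((complex \<Rightarrow> complex) \<Rightarrow> (complex \<Rightarrow> complex)) \<Rightarrow> bool" where
  "weighted_shift w B \<longleftrightarrow>
     continuous_linear_operator B \<and>
     (\<forall>n\<ge>1. w n \<noteq> 0) \<and>
     (\<forall>n\<ge>1. B (\<lambda>z. z ^ n) = (\<lambda>z. w n * z ^ (n - 1))) \<and>
     B (\<lambda>z. 1) = (\<lambda>z. 0)"

definition hypercyclic_vector ::
    "((complex \<Rightarrow> complex) \<Rightarrow> (complex \<Rightarrow> complex)) \<Rightarrow> (complex \<Rightarrow> complex) \<Rightarrow> bool" where
  "hypercyclic_vector T x \<longleftrightarrow>
     x \<in> entire \<and> entire_topology closure_of {(T ^^ n) x |n. n \<ge> 1} = entire"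

definition hypercyclic :: "((complex \<Rightarrow> complex) \<Rightarrow> (complex \<Rightarrow> complex)) \<Rightarrow> bool" where
  "hypercyclic T \<longleftrightarrow> (\<exists>x. hypercyclic_vector T x)"

definition hypercyclic_subspace ::
    "((complex \<Rightarrow> complex) \<Rightarrow> (complex \<Rightarrow> complex)) \<Rightarrow> (complex \<Rightarrow> complex) set \<Rightarrow> bool" where
  "hypercyclic_subspace T M \<longleftrightarrow>
     cfun.subspace M \<and> closedin entire_topology M \<and>
     \<not> (\<exists>F. finite F \<and> cfun.span F = M) \<and>
     (\<forall>x\<in>M. x \<noteq> 0 \<longrightarrow> hypercyclic_vector T x)"

end

theory Submission imports Defs begin

text \<open>Put \<open>W n = w 1 * \<dots> * w n\<close>. Then \<open>B ^^ n\<close> moves the coefficient at \<open>n + k\<close> to \<open>k\<close> and multiplies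
  it by \<open>W (n + k) / W k\<close>, and cutting index intervals greedily into short blocks turns lower bounds
  for \<open>W N / W (N - l)\<close> with bounded \<open>l\<close> into lower bounds uniform in the length of the interval.

  If the condition fails for every \<open>m\<close>, it follows that for every \<open>m\<close> and all large \<open>n\<close> the
  inequality \<open>m ^ (n + k) * norm (W k) \<le> norm (W (n + k))\<close> holds for all \<open>k\<close>. A closed
  infinite-dimensional subspace contains a vector whose Taylor coefficients decay as slowly, along
  sparse indices, as an entire function permits; its orbit eventually avoids a neighbourhood of 0.

  If the condition holds for \<open>m\<close> and \<open>M = 2 * m\<close>, then for every \<open>L\<close> there are arbitrarily large \<open>N\<close> with
  \<open>norm (W N) \<le> M ^ N * norm (W (N - l))\<close> for all \<open>l \<le> L\<close>. Such indices, carrying free coefficients,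
  are interlaced with finite blocks carrying preimages, under powers \<open>B ^^ n k\<close>, of a dense sequence of
  polynomials, each block being multiplied by one of the free coefficients. These relations define
  a closed subspace. The power \<open>B ^^ n k\<close> annihilates what precedes the \<open>k\<close>-th block, maps this block to a
  multiple of the \<open>k\<close>-th polynomial, makes later blocks negligible, and maps the later free
  coefficients of \<open>x\<close> to something bounded on the disc of radius \<open>r\<close> by a tail of the convergent series
  with terms \<open>norm (tcoeff x l) * (M * r) ^ l\<close>.\<close>

section \<open>Taylor coefficients of entire functions\<close>

definition tcoeff :: "(complex \<Rightarrow> complex) \<Rightarrow> nat \<Rightarrow> complex" where
  "tcoeff f j = (deriv ^^ j) f 0 / fact j"

lemma tcoeff_sums:
  assumes "f \<in> entire"
  shows "(\<lambda>j. tcoeff f j * z ^ j) sums f z"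
proof -
  have "f holomorphic_on ball 0 (norm z + 1)"
    using assms by (auto simp: entire_def intro: holomorphic_on_subset)
  from holomorphic_power_series[OF this, of z] show ?thesis
    by (simp add: tcoeff_def)
qed

lemma entire_powser:
  assumes "\<And>z. (\<lambda>j. a j * z ^ j) sums f z"
  shows entire_if_sums: "f \<in> entire" and tcoeff_if_sums: "tcoeff f j = a j"
proof -
  have "f holomorphic_on ball 0 r" for r
    by (rule power_series_holomorphic[of 0 r a]) (use assms in simp)
  then have "f analytic_on UNIV"
    unfolding analytic_on_def
    by (metis ball_subset_cball dist_commute dist_norm holomorphic_on_subset mem_ball_0 
        open_ball open_contains_ball_eq linordered_field_no_ub)
  then show E: "f \<in> entire" by (simp add: entire_def analytic_imp_holomorphic)
  have "f has_fps_expansion Abs_fps a"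
    using assms by (intro has_fps_expansionI) auto
  moreover have "f has_fps_expansion Abs_fps (tcoeff f)"
    using tcoeff_sums[OF E] by (intro has_fps_expansionI) auto
  ultimately have "Abs_fps a = Abs_fps (tcoeff f)"
    by (rule fps_expansion_unique_complex)
  then show "tcoeff f j = a j" by (metis Abs_fps_inverse UNIV_I fps_nth_Abs_fps)
qed

lemma entire_eqI:
  assumes "f \<in> entire" "g \<in> entire" "\<And>j. tcoeff f j = tcoeff g j"
  shows "f = g"
  using tcoeff_sums[OF assms(1)] tcoeff_sums[OF assms(2)] assms(3)
  by (metis ext sums_unique2)

lemma entire_add: "f \<in> entire \<Longrightarrow> g \<in> entire \<Longrightarrow> f + g \<in> entire"
  and entire_diff: "f \<in> entire \<Longrightarrow> g \<in> entire \<Longrightarrow> f - g \<in> entire"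
  and entire_cscale: "f \<in> entire \<Longrightarrow> cscale c f \<in> entire"
  and entire_zero: "0 \<in> entire"
  by (auto simp: entire_def plus_fun_def fun_diff_def cscale_def zero_fun_def
      intro!: holomorphic_intros)

lemma tcoeff_add: "f \<in> entire \<Longrightarrow> g \<in> entire \<Longrightarrow> tcoeff (f + g) j = tcoeff f j + tcoeff g j"
  by (rule tcoeff_if_sums) (auto simp: distrib_right plus_fun_def intro!: sums_add tcoeff_sums)

lemma tcoeff_diff: "f \<in> entire \<Longrightarrow> g \<in> entire \<Longrightarrow> tcoeff (f - g) j = tcoeff f j - tcoeff g j"
  by (rule tcoeff_if_sums) (auto simp: left_diff_distrib fun_diff_def intro!: sums_diff tcoeff_sums)

lemma tcoeff_cscale: "f \<in> entire \<Longrightarrow> tcoeff (cscale c f) j = c * tcoeff f j"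
  by (rule tcoeff_if_sums) (auto simp: mult.assoc cscale_def intro!: sums_mult tcoeff_sums)

lemma tcoeff_zero [simp]: "tcoeff 0 j = 0"
  by (rule tcoeff_if_sums) (auto simp: zero_fun_def)

lemma norm_tcoeff_le:
  assumes "f \<in> entire" "0 < r" "\<And>z. norm z \<le> r \<Longrightarrow> norm (f z) \<le> b"
  shows "norm (tcoeff f j) * r ^ j \<le> b"
proof -
  have "norm ((deriv ^^ j) f 0) \<le> fact j * b / r ^ j"
    using assms by (intro Cauchy_inequality)
      (auto simp: entire_def intro: holomorphic_on_subset holomorphic_on_imp_continuous_on)
  then show ?thesis
    using assms(2) by (simp add: tcoeff_def norm_divide field_simps)
qed

lemma summable_tcoeff:
  assumes "f \<in> entire" "0 \<le> r"
  shows "summable (\<lambda>j. norm (tcoeff f j) * r ^ j)"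
proof -
  \<comment> \<open>Convergence at the larger point \<open>r + 1\<close> gives absolute convergence
    at modulus \<open>r\<close>.\<close>
  have "summable (\<lambda>j. norm (tcoeff f j * of_real r ^ j))"
    by (rule powser_insidea[OF sums_summable[OF tcoeff_sums[OF assms(1), of "of_real (r + 1)"]]])
      (use assms(2) in \<open>simp del: of_real_add\<close>)
  then show ?thesis using assms(2) by (simp add: norm_mult norm_power)
qed

lemma norm_le_suminf_tcoeff:
  assumes "f \<in> entire" "norm z \<le> r"
  shows "norm (f z) \<le> (\<Sum>j. norm (tcoeff f j) * r ^ j)"
proof -
  have "0 \<le> r" using assms(2) norm_ge_zero order_trans by blast
  note s = summable_tcoeff[OF assms(1) this]
  have le: "norm (tcoeff f j * z ^ j) \<le> norm (tcoeff f j) * r ^ j" for j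
    by (simp add: norm_mult norm_power assms(2) mult_left_mono power_mono)
  have "norm (f z) = norm (\<Sum>j. tcoeff f j * z ^ j)"
    using tcoeff_sums[OF assms(1), of z] by (simp add: sums_iff)
  also have "\<dots> \<le> (\<Sum>j. norm (tcoeff f j) * r ^ j)"
    by (rule norm_suminf_le[OF le s])
  finally show ?thesis .
qed

definition powser :: "(nat \<Rightarrow> complex) \<Rightarrow> complex \<Rightarrow> complex" where
  "powser a z = (\<Sum>j. a j * z ^ j)"

lemma powser_entire:
  assumes "\<And>r::nat. summable (\<lambda>j. norm (a j) * real r ^ j)"
  shows powser_in_entire: "powser a \<in> entire" and tcoeff_powser: "tcoeff (powser a) j = a j"
proof -
  have "(\<lambda>j. a j * z ^ j) sums powser a z" for z
  proof -
    obtain r :: nat where r: "norm z \<le> real r" using real_arch_simple by blast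
    have "summable (\<lambda>j. a j * z ^ j)"
      by (rule summable_comparison_test'[OF assms[of r], of 0])
        (simp add: norm_mult norm_power r mult_left_mono power_mono)
    then show ?thesis by (simp add: powser_def summable_sums)
  qed
  then show "powser a \<in> entire" "tcoeff (powser a) j = a j" by (rule entire_powser)+
qed

lemma entire_monom: "(\<lambda>z. z ^ n) \<in> entire"
  by (auto simp: entire_def intro!: holomorphic_intros)

lemma tcoeff_monom: "tcoeff (\<lambda>z. z ^ n) j = (if j = n then 1 else 0)"
proof (rule tcoeff_if_sums)
  fix z :: complex
  have "(\<lambda>j. if j = n then z ^ j else 0) sums (z ^ n)" by (rule sums_single)
  then show "(\<lambda>j. (if j = n then 1 else 0) * z ^ j) sums (z ^ n)"
    by (rule back_subst[where P = "\<lambda>f. f sums (z ^ n)"]) auto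
qed

text \<open>Every compact set lies in a disc around 0 of integer radius, so such discs suffice as
  test sets.\<close>

lemma openin_entire_nhd:
  assumes "openin entire_topology U" "f \<in> U"
  obtains r :: nat and e where "1 \<le> r" "0 < e"
    "\<And>g. g \<in> entire \<Longrightarrow> (\<forall>z. norm z \<le> real r \<longrightarrow> norm (g z - f z) < e) \<Longrightarrow> g \<in> U"
proof -
  obtain K e where K: "compact K" "0 < e"
    "\<forall>g\<in>entire. (\<forall>z\<in>K. dist (g z) (f z) < e) \<longrightarrow> g \<in> U"
    using assms unfolding openin_entire_topology by metis
  obtain b where b: "\<forall>z\<in>K. norm z \<le> b"
    using compact_imp_bounded[OF K(1)] unfolding bounded_iff by blast
  obtain r :: nat where r: "b \<le> real r" using real_arch_simple by blast
  show ?thesis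
  proof (rule that[of "r + 1" e])
    fix g assume g: "g \<in> entire" "\<forall>z. norm z \<le> real (r + 1) \<longrightarrow> norm (g z - f z) < e"
    have "dist (g z) (f z) < e" if "z \<in> K" for z
      using g(2) b r that by (force simp: dist_norm)
    then show "g \<in> U" using K(3) g(1) by blast
  qed (use K in auto)
qed

lemma suminf_tail_lt:
  fixes g :: "nat \<Rightarrow> real"
  assumes "summable g" "0 < e"
  obtains N where "\<And>n. N \<le> n \<Longrightarrow> (\<Sum>i. g (i + n)) < e"
proof -
  obtain N where "\<forall>n\<ge>N. norm (\<Sum>i. g (i + n)) < e"
    using suminf_exist_split[OF assms(2,1)] by blast
  then show thesis by (intro that[of N]) (auto simp: abs_less_iff)
qed

lemma norm_less_if_tcoeff_le:
  assumes "f \<in> entire" "norm z \<le> r" "\<And>j. norm (tcoeff f j) * r ^ j \<le> g j" "summable g" "suminf g < e"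
  shows "norm (f z) < e"
proof -
  have "0 \<le> r" using assms(2) norm_ge_zero order_trans by blast
  have "norm (f z) \<le> (\<Sum>j. norm (tcoeff f j) * r ^ j)"
    by (rule norm_le_suminf_tcoeff[OF assms(1,2)])
  also have "\<dots> \<le> suminf g"
    by (rule suminf_le[OF assms(3) summable_tcoeff[OF assms(1) \<open>0 \<le> r\<close>] assms(4)])
  finally show ?thesis using assms(5) by simp
qed

definition taylor_sum :: "(complex \<Rightarrow> complex) \<Rightarrow> nat \<Rightarrow> complex \<Rightarrow> complex" where
  "taylor_sum f N = (\<Sum>j<N. cscale (tcoeff f j) (\<lambda>z. z ^ j))"

lemma taylor_sum_Suc: "taylor_sum f (Suc N) = taylor_sum f N + cscale (tcoeff f N) (\<lambda>z. z ^ N)"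
  by (simp add: taylor_sum_def)

lemma entire_taylor_sum: "taylor_sum f N \<in> entire"
proof (rule nat_induct)
  show "taylor_sum f 0 \<in> entire" by (simp add: taylor_sum_def entire_zero)
  fix N assume "taylor_sum f N \<in> entire"
  then show "taylor_sum f (Suc N) \<in> entire"
    by (simp add: taylor_sum_Suc entire_add entire_cscale entire_monom)
qed

lemma tcoeff_taylor_sum: "tcoeff (taylor_sum f N) j = (if j < N then tcoeff f j else 0)"
proof (rule nat_induct[of _ N])
  show "tcoeff (taylor_sum f 0) j = (if j < 0 then tcoeff f j else 0)"
    by (simp add: taylor_sum_def)
  fix N assume "tcoeff (taylor_sum f N) j = (if j < N then tcoeff f j else 0)"
  then show "tcoeff (taylor_sum f (Suc N)) j = (if j < Suc N then tcoeff f j else 0)"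
    by (auto simp: taylor_sum_Suc tcoeff_add tcoeff_cscale tcoeff_monom entire_taylor_sum
        entire_cscale entire_monom less_Suc_eq)
qed

lemma taylor_sum_approx:
  assumes "f \<in> entire" "0 \<le> r" "0 < e"
  obtains N where "\<And>n z. N \<le> n \<Longrightarrow> norm z \<le> r \<Longrightarrow> norm (f z - taylor_sum f n z) < e"
proof -
  let ?g = "\<lambda>j. norm (tcoeff f j) * r ^ j"
  note s = summable_tcoeff[OF assms(1,2)]
  obtain N where N: "\<And>n. N \<le> n \<Longrightarrow> (\<Sum>i. ?g (i + n)) < e"
    using suminf_tail_lt[OF s assms(3)] by blast
  show ?thesis
  proof (rule that)
    fix n z assume nz: "N \<le> n" "norm (z::complex) \<le> r"
    let ?h = "\<lambda>j. if j < n then 0 else ?g j"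
    have s': "summable ?h"
      by (rule summable_comparison_test'[OF s, of 0]) (use assms(2) in auto)
    have "suminf ?h = (\<Sum>i. ?h (i + n)) + (\<Sum>i<n. ?h i)"
      by (rule suminf_split_initial_segment[OF s'])
    also have "\<dots> = (\<Sum>i. ?g (i + n))" by simp
    finally have "suminf ?h < e" using N[OF nz(1)] by simp
    moreover have "norm (tcoeff (f - taylor_sum f n) j) * r ^ j \<le> ?h j" for j
      by (simp add: assms(1) entire_taylor_sum tcoeff_diff tcoeff_taylor_sum)
    ultimately have "norm ((f - taylor_sum f n) z) < e"
      by (intro norm_less_if_tcoeff_le[OF entire_diff[OF assms(1) entire_taylor_sum] nz(2) _ s'])
    then show "norm (f z - taylor_sum f n z) < e" by (simp add: fun_diff_def)
  qed
qed

text \<open>One bound \<open>d < e\<close> for the whole disc leaves the margin \<open>e - d\<close>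
  for perturbations, so \<open>f\<close> may be arbitrary and no maximum over the disc has to be
  attained.\<close>

lemma openin_entire_ball:
  "openin entire_topology {g \<in> entire. \<exists>d<e. \<forall>z. norm z \<le> r \<longrightarrow> norm (g z - f z) \<le> d}"
  (is "openin _ ?U")
  unfolding openin_entire_topology
proof (intro conjI ballI)
  fix g assume "g \<in> ?U"
  then obtain d where d: "d < e" "\<And>z. norm z \<le> r \<Longrightarrow> norm (g z - f z) \<le> d" by blast
  show "\<exists>K a. compact K \<and> 0 < a \<and> (\<forall>h\<in>entire. (\<forall>z\<in>K. dist (h z) (g z) < a) \<longrightarrow> h \<in> ?U)"
  proof (intro exI conjI ballI impI)
    show "compact (cball 0 r :: complex set)" "0 < (e - d) / 2" using d by simp_all
    fix h assume h: "h \<in> entire" "\<forall>z\<in>cball 0 r. dist (h z) (g z) < (e - d) / 2"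
    have "norm (h z - f z) \<le> (e + d) / 2" if "norm z \<le> r" for z
    proof -
      have "norm (h z - g z) < (e - d) / 2" using h(2) that by (auto simp: dist_norm)
      moreover have "norm (h z - f z) \<le> norm (h z - g z) + norm (g z - f z)"
        using norm_triangle_ineq[of "h z - g z" "g z - f z"] by simp
      ultimately show ?thesis using d(2)[OF that] by (simp add: field_simps)
    qed
    then show "h \<in> ?U" using h(1) d(1) by (auto intro!: exI[of _ "(e + d) / 2"])
  qed
qed auto

section \<open>Weighted shifts in terms of coefficients\<close>

locale entire_weighted_shift =
  fixes w :: "nat \<Rightarrow> complex" and B :: "(complex \<Rightarrow> complex) \<Rightarrow> (complex \<Rightarrow> complex)"
  assumes shift: "weighted_shift w B"
begin

lemma B_continuous: "continuous_map entire_topology entire_topology B"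
  and B_add: "f \<in> entire \<Longrightarrow> g \<in> entire \<Longrightarrow> B (f + g) = B f + B g"
  and B_cscale: "f \<in> entire \<Longrightarrow> B (cscale c f) = cscale c (B f)"
  and B_monom: "1 \<le> n \<Longrightarrow> B (\<lambda>z. z ^ n) = (\<lambda>z. w n * z ^ (n - 1))"
  and B_one: "B (\<lambda>z. 1) = (\<lambda>z. 0)"
  and w_nonzero: "1 \<le> n \<Longrightarrow> w n \<noteq> 0"
  using shift by (auto simp: weighted_shift_def continuous_linear_operator_def)

lemma B_entire: "f \<in> entire \<Longrightarrow> B f \<in> entire"
  using continuous_map_image_subset_topspace[OF B_continuous] by auto

lemma B_zero: "B 0 = 0"
proof -
  have "B (cscale 0 0) = cscale 0 (B 0)" by (rule B_cscale[OF entire_zero])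
  then show ?thesis by (simp add: cscale_def zero_fun_def)
qed

text \<open>Continuity at 0, read off on the unit disc in the range: there Cauchy's estimate bounds
  every Taylor coefficient of \<open>B g\<close> by \<open>e\<close>.\<close>

lemma B_continuous_0:
  assumes "0 < e"
  obtains r :: nat and d where "1 \<le> r" "0 < d"
    "\<And>g z. g \<in> entire \<Longrightarrow> (\<forall>z. norm z \<le> real r \<longrightarrow> norm (g z) < d) \<Longrightarrow> norm z \<le> 1 \<Longrightarrow> norm (B g z) < e"
proof -
  let ?U = "{g \<in> entire. \<exists>d<e. \<forall>z. norm z \<le> 1 \<longrightarrow> norm (g z - 0 z) \<le> d}"
  have "openin entire_topology {f \<in> entire. B f \<in> ?U}"
    using openin_continuous_map_preimage[OF B_continuous openin_entire_ball[of e 1 0]] by simp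
  moreover have "0 \<in> {f \<in> entire. B f \<in> ?U}"
    using assms by (auto simp: B_zero entire_zero)
  ultimately obtain r :: nat and d where rd: "1 \<le> r" "0 < d"
    "\<And>g. g \<in> entire \<Longrightarrow> (\<forall>z. norm z \<le> real r \<longrightarrow> norm (g z - 0 z) < d) \<Longrightarrow> g \<in> {f \<in> entire. B f \<in> ?U}"
    by (rule openin_entire_nhd) blast
  show ?thesis
  proof (rule that[OF rd(1,2)])
    fix g z assume "g \<in> entire" "\<forall>z. norm z \<le> real r \<longrightarrow> norm (g z) < d" "norm (z::complex) \<le> 1"
    with rd(3)[of g] show "norm (B g z) < e" by force
  qed
qed

text \<open>Continuity at 0 is tested on monomials scaled to be small on the disc of radius
  \<open>r\<close>; the value of the image at 1 bounds the weight.\<close>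

lemma weights_exp_bounded:
  obtains C where "1 \<le> C" "\<And>n. 1 \<le> n \<Longrightarrow> norm (w n) \<le> C ^ n"
proof -
  obtain r :: nat and d where rd: "1 \<le> r" "0 < d"
    "\<And>g z. g \<in> entire \<Longrightarrow> (\<forall>z. norm z \<le> real r \<longrightarrow> norm (g z) < d) \<Longrightarrow> norm z \<le> 1 \<Longrightarrow> norm (B g z) < 1"
    using B_continuous_0[of 1] by auto
  \<comment> \<open>Since \<open>1 <= K\<close> and \<open>2 / d <= K\<close>, the constant
    \<open>2 / d\<close> is absorbed into \<open>K ^ n\<close> for \<open>n >= 1\<close>.\<close>
  define K where "K = max 1 (2 / d)"
  show ?thesis
  proof (rule that[of "K * r"])
    show "1 \<le> K * real r" using mult_mono[of 1 K 1 "real r"] rd(1) by (simp add: K_def)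
    fix n :: nat assume n: "1 \<le> n"
    define c where "c = d / (2 * real r ^ n)"
    have c: "0 < c" using rd by (simp add: c_def)
    let ?g = "cscale (of_real c) (\<lambda>z. z ^ n)"
    have "norm (B ?g 1) < 1"
    proof (rule rd(3))
      show "?g \<in> entire" by (intro entire_cscale entire_monom)
      show "\<forall>z. norm z \<le> real r \<longrightarrow> norm (?g z) < d"
      proof (intro allI impI)
        fix z :: complex assume z: "norm z \<le> real r"
        have "norm (?g z) = c * norm z ^ n"
          using c by (simp add: cscale_def norm_mult norm_power)
        also have "\<dots> \<le> c * real r ^ n"
          using c z by (intro mult_left_mono power_mono) auto
        also have "\<dots> < d" using rd by (simp add: c_def)
        finally show "norm (?g z) < d" .
      qed
    qed simp
    moreover have "B ?g = cscale (of_real c) (\<lambda>z. w n * z ^ (n - 1))"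
      using n by (simp add: B_cscale[OF entire_monom] B_monom)
    ultimately have "c * norm (w n) < 1" using c by (simp add: cscale_def norm_mult)
    then have "norm (w n) < 1 / c" using c by (simp add: field_simps)
    also have "1 / c = (2 / d) * real r ^ n" by (simp add: c_def)
    also have "\<dots> \<le> K ^ n * real r ^ n"
    proof (rule mult_right_mono)
      have "2 / d \<le> K ^ 1" by (simp add: K_def)
      also have "\<dots> \<le> K ^ n" using n by (intro power_increasing) (auto simp: K_def)
      finally show "2 / d \<le> K ^ n" .
    qed simp
    finally show "norm (w n) \<le> (K * real r) ^ n" by (simp add: power_mult_distrib)
  qed
qed

lemma tcoeff_B_taylor_sum:
  "tcoeff (B (taylor_sum f N)) j = (if Suc j < N then w (Suc j) * tcoeff f (Suc j) else 0)"
proof (rule nat_induct[of _ N])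
  show "tcoeff (B (taylor_sum f 0)) j = (if Suc j < 0 then w (Suc j) * tcoeff f (Suc j) else 0)"
    by (simp add: taylor_sum_def B_zero)
  fix N assume IH: "tcoeff (B (taylor_sum f N)) j = (if Suc j < N then w (Suc j) * tcoeff f (Suc j) else 0)"
  have *: "tcoeff (B (\<lambda>z. z ^ N)) j = (if Suc j = N then w (Suc j) else 0)"
  proof (cases N)
    case 0
    then have "B (\<lambda>z. z ^ N) = 0" using B_one by (simp add: zero_fun_def)
    then show ?thesis using 0 by simp
  next
    case (Suc m)
    then have "B (\<lambda>z. z ^ N) = cscale (w N) (\<lambda>z. z ^ m)" using B_monom[of N] by (simp add: cscale_def)
    then show ?thesis using Suc by (auto simp: tcoeff_cscale entire_monom tcoeff_monom)
  qed
  have "B (taylor_sum f (Suc N)) = B (taylor_sum f N) + cscale (tcoeff f N) (B (\<lambda>z. z ^ N))"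
    by (simp add: taylor_sum_Suc B_add B_cscale entire_taylor_sum entire_cscale entire_monom)
  then show "tcoeff (B (taylor_sum f (Suc N))) j = (if Suc j < Suc N then w (Suc j) * tcoeff f (Suc j) else 0)"
    by (auto simp: entire_taylor_sum entire_cscale entire_monom tcoeff_add B_entire tcoeff_cscale IH * dest: Suc_lessI)
qed

text \<open>For Taylor polynomials this is linearity. Continuity makes the image of a Taylor
  remainder smaller than \<open>e\<close> on the unit disc, so its \<open>j\<close>-th coefficient
  is at most \<open>e\<close>.\<close>

lemma tcoeff_B:
  assumes f: "f \<in> entire"
  shows "tcoeff (B f) j = w (Suc j) * tcoeff f (Suc j)"
proof -
  have "norm (tcoeff (B f) j - w (Suc j) * tcoeff f (Suc j)) \<le> 0 + e" if e: "0 < e" for e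
  proof -
    obtain r :: nat and d where rd: "1 \<le> r" "0 < d"
      "\<And>g z. g \<in> entire \<Longrightarrow> (\<forall>z. norm z \<le> real r \<longrightarrow> norm (g z) < d) \<Longrightarrow> norm z \<le> 1 \<Longrightarrow> norm (B g z) < e"
      using B_continuous_0[OF e] by auto
    obtain N where N: "\<And>n z. N \<le> n \<Longrightarrow> norm z \<le> real r \<Longrightarrow> norm (f z - taylor_sum f n z) < d"
      using taylor_sum_approx[OF f _ rd(2), of "real r"] by auto
    define n where "n = max N (j + 2)"
    have "Suc j < n" by (simp add: n_def)
    let ?g = "f - taylor_sum f n"
    have g: "?g \<in> entire" by (simp add: f entire_diff entire_taylor_sum)
    have "norm (tcoeff (B ?g) j) * 1 ^ j \<le> e"
    proof (rule norm_tcoeff_le)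
      fix z :: complex assume z: "norm z \<le> 1"
      have "\<forall>z. norm z \<le> real r \<longrightarrow> norm (?g z) < d"
        using N[of n] by (simp add: n_def fun_diff_def)
      then show "norm (B ?g z) \<le> e" by (intro less_imp_le[OF rd(3)] g z)
    qed (auto intro: B_entire g)
    moreover have "B f = B ?g + B (taylor_sum f n)"
      using B_add[OF g entire_taylor_sum, of f n] by (simp add: fun_eq_iff)
    then have "tcoeff (B f) j = tcoeff (B ?g) j + w (Suc j) * tcoeff f (Suc j)"
      using \<open>Suc j < n\<close>
      by (simp add: tcoeff_add[OF B_entire[OF g] B_entire[OF entire_taylor_sum]] tcoeff_B_taylor_sum)
    ultimately show ?thesis by simp
  qed
  then have "norm (tcoeff (B f) j - w (Suc j) * tcoeff f (Suc j)) \<le> 0"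
    by (rule field_le_epsilon)
  then show ?thesis by simp
qed

definition W :: "nat \<Rightarrow> complex" where
  "W n = (\<Prod>\<nu>=1..n. w \<nu>)"

lemma W_0 [simp]: "W 0 = 1" and W_Suc: "W (Suc n) = w (Suc n) * W n"
  by (simp_all add: W_def atLeastAtMostSuc_conv mult.commute)

lemma W_nonzero [simp]: "W n \<noteq> 0"
  by (simp add: W_def w_nonzero)

lemma prod_weights: "(\<Prod>\<nu>=1..n. norm (w (\<nu> + k))) = norm (W (n + k)) / norm (W k)"
  by (induction n) (simp_all add: W_Suc norm_mult)

lemma entire_B_pow: "f \<in> entire \<Longrightarrow> (B ^^ n) f \<in> entire"
  by (induction n) (simp_all add: B_entire)

lemma tcoeff_B_pow:
  assumes "f \<in> entire"
  shows "tcoeff ((B ^^ n) f) j = W (n + j) / W j * tcoeff f (n + j)"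
proof (induction n arbitrary: j)
  case (Suc n)
  have "tcoeff ((B ^^ Suc n) f) j = w (Suc j) * tcoeff ((B ^^ n) f) (Suc j)"
    by (simp add: tcoeff_B entire_B_pow assms)
  also have "\<dots> = w (Suc j) * (W (n + Suc j) / W (Suc j) * tcoeff f (n + Suc j))"
    by (simp only: Suc)
  also have "\<dots> = W (Suc n + j) / W j * tcoeff f (Suc n + j)"
    using w_nonzero[of "Suc j"] by (simp add: W_Suc[of j])
  finally show ?case .
qed simp

end

section \<open>Growth of the weight products\<close>

text \<open>Greedy decomposition of the index interval from \<open>a\<close> to \<open>t\<close> into blocks of length at most \<open>L\<close>,
  starting at the top: each of the at least \<open>q + 1\<close> blocks contributes a factor \<open>M\<close> to the
  power of its top index, and \<open>C ^ (a * L)\<close> pays for the part of the last block that lies below \<open>a\<close>.\<close>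

lemma growth_from_blocks:
  fixes V :: "nat \<Rightarrow> real"
  assumes V: "\<And>n. 0 < V n" "\<And>n. V (Suc n) \<le> C ^ Suc n * V n"
    and C: "1 \<le> C" and M: "1 \<le> M"
    and blocks: "\<And>t. Q \<le> t \<Longrightarrow> \<exists>l\<ge>1. l \<le> L \<and> l \<le> t \<and> M ^ t * V (t - l) \<le> V t"
  shows "\<lbrakk>Q \<le> a; a < t; q * L < t - a\<rbrakk> \<Longrightarrow> M ^ (t + a * q) * V a \<le> V t * C ^ (a * L)"
proof (induction t arbitrary: q rule: less_induct)
  case (less t)
  obtain l where l: "1 \<le> l" "l \<le> L" "l \<le> t" "M ^ t * V (t - l) \<le> V t"
    using blocks[of t] less.prems by auto
  have C1: "1 \<le> C ^ n" for n using C by simp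
  have M1: "1 \<le> M ^ n" for n using M by simp
  show ?case
  proof (cases "t - l > a")
    case True
    have IH: "M ^ (a * q) * V a \<le> V (t - l) * C ^ (a * L)"
    proof (cases q)
      case 0
      have "M ^ (t - l + a * 0) * V a \<le> V (t - l) * C ^ (a * L)"
        by (rule less.IH) (use True l less.prems in auto)
      moreover have "1 * V a \<le> M ^ (t - l) * V a"
        by (rule mult_right_mono) (use M1 V(1)[of a] in auto)
      ultimately show ?thesis using 0 by simp
    next
      case (Suc p)
      have "M ^ (t - l + a * p) * V a \<le> V (t - l) * C ^ (a * L)"
        by (rule less.IH) (use True l less.prems Suc in auto)
      \<comment> \<open>As \<open>a < t - l\<close>, the exponent \<open>t - l + a * p\<close> is at
        least \<open>a + a * p\<close>, which is \<open>a * q\<close>.\<close>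
      moreover have "M ^ (a * q) * V a \<le> M ^ (t - l + a * p) * V a"
        using True Suc M V(1)[of a] by (intro mult_right_mono power_increasing) (auto simp: less_imp_le)
      ultimately show ?thesis by linarith
    qed
    have "M ^ (t + a * q) * V a = M ^ t * (M ^ (a * q) * V a)" by (simp add: power_add)
    also have "\<dots> \<le> M ^ t * (V (t - l) * C ^ (a * L))"
      by (rule mult_left_mono[OF IH]) (use M in simp)
    also have "\<dots> \<le> V t * C ^ (a * L)"
      using mult_right_mono[OF l(4), of "C ^ (a * L)"] C by (simp add: mult.assoc)
    finally show ?thesis .
  next
    case False
    \<comment> \<open>The last block reaches down to \<open>a\<close> or below: then
      \<open>t - a <= l <= L\<close>, and \<open>q * L < t - a\<close> leaves only
      \<open>q = 0\<close>.\<close>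
    have q: "q = 0"
    proof (rule ccontr)
      assume "q \<noteq> 0"
      then have "L \<le> q * L" by simp
      then show False using False l less.prems by linarith
    qed
    have step: "V (s + i) \<le> C ^ (a * i) * V s" if "s + i \<le> a" for s i
      using that
    proof (induction i)
      case (Suc i)
      have "V (s + Suc i) \<le> C ^ Suc (s + i) * V (s + i)" using V(2)[of "s + i"] by simp
      also have "\<dots> \<le> C ^ a * V (s + i)"
        using Suc.prems C V(1)[of "s + i"] by (intro mult_right_mono power_increasing) auto
      also have "\<dots> \<le> C ^ a * (C ^ (a * i) * V s)"
        using Suc C by (intro mult_left_mono) auto
      finally show ?case by (simp add: power_add mult.assoc)
    qed simp
    have "V a \<le> C ^ (a * (a - (t - l))) * V (t - l)"
      using step[of "t - l" "a - (t - l)"] False by simp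
    also have "\<dots> \<le> C ^ (a * L) * V (t - l)"
      using C V(1)[of "t - l"] less.prems l by (intro mult_right_mono power_increasing) auto
    finally have "M ^ t * V a \<le> M ^ t * (C ^ (a * L) * V (t - l))"
      using M by (intro mult_left_mono) auto
    also have "\<dots> \<le> C ^ (a * L) * V t"
      using mult_left_mono[OF l(4), of "C ^ (a * L)"] C by (simp add: ac_simps)
    finally show ?thesis using q by (simp add: mult.commute)
  qed
qed

text \<open>The loss \<open>C ^ (k * L)\<close> in \<open>growth_from_blocks\<close> is absorbed by
  \<open>M ^ (k * q)\<close> once \<open>C ^ L < M ^ q\<close>; intervals longer than
  \<open>q * L\<close> provide that gain. Small \<open>k\<close> are compared with the fixed start
  \<open>R\<close>.\<close>

lemma uniform_growth_from_blocks:
  fixes V :: "nat \<Rightarrow> real"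
  assumes V: "\<And>n. 0 < V n" "\<And>n. V (Suc n) \<le> C ^ Suc n * V n"
    and C: "1 \<le> C" and M: "1 < M"
    and blocks: "\<And>t. Q \<le> t \<Longrightarrow> \<exists>l\<ge>1. l \<le> L \<and> l \<le> t \<and> M ^ t * V (t - l) \<le> V t"
  obtains n0 where "\<And>n k. n0 \<le> n \<Longrightarrow> M ^ (n + k) * V k \<le> V (n + k)"
proof -
  \<comment> \<open>Taking \<open>1 <= R\<close> gives \<open>M ^ q <= M ^ (R * q)\<close>, needed
    in the case \<open>k < R\<close>.\<close>
  define R where "R = max Q 1"
  have R: "Q \<le> R" "1 \<le> R" by (auto simp: R_def)
  define b where "b = (\<Sum>a\<le>R. V a / V R)"
  have b: "V a \<le> b * V R" if "a \<le> R" for a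
  proof -
    have "V a / V R \<le> b"
      unfolding b_def using that V(1)
      by (intro member_le_sum[of a "{..R}" "\<lambda>a. V a / V R"]) (auto simp: less_imp_le)
    then show ?thesis using V(1)[of R] by (simp add: field_simps)
  qed
  obtain q where q: "max (C ^ L) (b * C ^ (R * L)) < M ^ q"
    using real_arch_pow[OF M] by blast
  note growth = growth_from_blocks[OF V C less_imp_le[OF M] blocks]
  show ?thesis
  proof (rule that[of "R + q * L + 1"])
    fix n k assume n: "R + q * L + 1 \<le> n"
    show "M ^ (n + k) * V k \<le> V (n + k)"
    proof (cases "R \<le> k")
      case True
      have "C ^ (k * L) \<le> M ^ (k * q)"
      proof -
        have "(C ^ L) ^ k \<le> (M ^ q) ^ k" using q C by (intro power_mono) auto
        then show ?thesis by (simp add: power_mult[symmetric] mult.commute)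
      qed
      then have "V (n + k) * C ^ (k * L) \<le> V (n + k) * M ^ (k * q)"
        using V(1)[of "n + k"] by (intro mult_left_mono) auto
      moreover have "M ^ (n + k + k * q) * V k \<le> V (n + k) * C ^ (k * L)"
        by (rule growth) (use n R True in auto)
      ultimately have "M ^ (k * q) * (M ^ (n + k) * V k) \<le> M ^ (k * q) * V (n + k)"
        by (simp add: power_add mult_ac)
      then show ?thesis using M by simp
    next
      case False
      have C0: "0 < C ^ (R * L)" using C by simp
      have "b * C ^ (R * L) \<le> M ^ q" using q by simp
      also have "\<dots> \<le> M ^ (R * q)" using M R by (intro power_increasing) auto
      finally have bq: "b * C ^ (R * L) \<le> M ^ (R * q)" .
      have g: "M ^ (n + k + R * q) * V R \<le> V (n + k) * C ^ (R * L)"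
        by (rule growth) (use n R False in auto)
      have "C ^ (R * L) * (M ^ (n + k) * V k) \<le> C ^ (R * L) * (M ^ (n + k) * (b * V R))"
        using b[of k] False M C0 by (intro mult_left_mono) auto
      also have "\<dots> = (b * C ^ (R * L)) * (M ^ (n + k) * V R)" by (simp add: mult_ac)
      also have "\<dots> \<le> M ^ (R * q) * (M ^ (n + k) * V R)"
        using bq M V(1)[of R] by (intro mult_right_mono) auto
      also have "\<dots> \<le> C ^ (R * L) * V (n + k)" using g by (simp add: power_add mult_ac)
      finally show ?thesis using C0 by simp
    qed
  qed
qed

section \<open>Absence of hypercyclic subspaces\<close>

lemma hypercyclic_vectorD:
  assumes "hypercyclic_vector T x" "f \<in> entire" "0 < e"
  obtains n where "1 \<le> n" "\<And>z. norm z \<le> r \<Longrightarrow> norm ((T ^^ n) x z - f z) < e"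
proof -
  let ?U = "{g \<in> entire. \<exists>d<e. \<forall>z. norm z \<le> r \<longrightarrow> norm (g z - f z) \<le> d}"
  have fU: "f \<in> ?U" using assms(2,3) by (auto intro: exI[of _ 0])
  have "f \<in> entire_topology closure_of {(T ^^ n) x |n. n \<ge> 1}"
    using assms(1,2) by (simp only: hypercyclic_vector_def)
  then have cl: "\<forall>V. f \<in> V \<and> openin entire_topology V \<longrightarrow> (\<exists>y. y \<in> {(T ^^ n) x |n. n \<ge> 1} \<and> y \<in> V)"
    unfolding in_closure_of by (rule conjunct2)
  obtain y where y: "y \<in> {(T ^^ n) x |n. n \<ge> 1}" "y \<in> ?U"
    using cl[rule_format, OF conjI[OF fU openin_entire_ball]] by (elim exE conjE)
  obtain n where n: "1 \<le> n" "y = (T ^^ n) x" using y(1) by blast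
  obtain d where "d < e" "\<And>z. norm z \<le> r \<Longrightarrow> norm (y z - f z) \<le> d" using y(2) by blast
  then show thesis using that[OF n(1)] n(2) by force
qed

lemma hypercyclic_vectorI:
  assumes "x \<in> entire" "\<And>n. (T ^^ n) x \<in> entire"
    and "\<And>f e r. \<lbrakk>f \<in> entire; 0 < e\<rbrakk> \<Longrightarrow>
      \<exists>n\<ge>1. \<forall>z. norm z \<le> real r \<longrightarrow> norm ((T ^^ n) x z - f z) < e"
  shows "hypercyclic_vector T x"
proof -
  have "f \<in> entire_topology closure_of {(T ^^ n) x |n. n \<ge> 1}" if f: "f \<in> entire" for f
    unfolding in_closure_of
  proof (intro conjI allI impI)
    fix U assume "f \<in> U \<and> openin entire_topology U"
    then obtain r :: nat and e where re: "0 < e"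
      "\<And>g. g \<in> entire \<Longrightarrow> (\<forall>z. norm z \<le> real r \<longrightarrow> norm (g z - f z) < e) \<Longrightarrow> g \<in> U"
      using openin_entire_nhd by metis
    obtain n where "n \<ge> 1" "\<forall>z. norm z \<le> real r \<longrightarrow> norm ((T ^^ n) x z - f z) < e"
      using assms(3)[OF f re(1)] by blast
    then show "\<exists>y. y \<in> {(T ^^ n) x |n. n \<ge> 1} \<and> y \<in> U"
      using re(2)[OF assms(2)] by blast
  qed (use f in simp)
  moreover have "entire_topology closure_of {(T ^^ n) x |n. n \<ge> 1} \<subseteq> entire"
    using closure_of_subset_topspace[of entire_topology] by simp
  ultimately show ?thesis using assms(1) unfolding hypercyclic_vector_def by blast
qed

text \<open>The kernel of a linear functional has codimension at most one: a single vector outside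
  it completes \<open>F\<close>.\<close>

lemma finite_dim_if_kernel_finite_dim:
  assumes M: "cfun.subspace M"
    and add: "\<And>x y. x \<in> M \<Longrightarrow> y \<in> M \<Longrightarrow> \<phi> (x - y) = \<phi> x - \<phi> y"
    and scale: "\<And>c x. x \<in> M \<Longrightarrow> \<phi> (cscale c x) = c * \<phi> x"
    and F: "finite F" "cfun.span F = {x \<in> M. \<phi> x = 0}"
  shows "\<exists>F. finite F \<and> cfun.span F = M"
proof (cases "\<forall>x\<in>M. \<phi> x = 0")
  case True
  then have "{x \<in> M. \<phi> x = 0} = M" by blast
  then show ?thesis using F by metis
next
  case False
  then obtain x0 where x0: "x0 \<in> M" "\<phi> x0 \<noteq> 0" by blast
  have "cfun.span (insert x0 F) = M"
  proof
    have "F \<subseteq> M" using F(2) cfun.span_superset by blast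
    then show "cfun.span (insert x0 F) \<subseteq> M"
      using x0 M by (intro cfun.span_minimal) auto
    show "M \<subseteq> cfun.span (insert x0 F)"
    proof
      fix x assume x: "x \<in> M"
      let ?y = "cscale (\<phi> x / \<phi> x0) x0"
      have y: "?y \<in> M" using M x0(1) by (rule cfun.subspace_scale)
      then have "x - ?y \<in> M" using M x by (simp add: cfun.subspace_diff)
      moreover have "\<phi> (x - ?y) = 0" using x0 by (simp only: add[OF x y] scale[OF x0(1)]) simp
      ultimately have "x - ?y \<in> cfun.span F" using F(2) by blast
      then show "x \<in> cfun.span (insert x0 F)" using cfun.span_breakdown_eq by blast
    qed
  qed
  then show ?thesis using F(1) by (metis finite_insert)
qed

text \<open>Each vanishing condition costs at most one dimension, so after \<open>N\<close> of them
  the space is still infinite-dimensional, in particular nonzero.\<close>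

lemma exists_vanishing_to_order:
  assumes M: "cfun.subspace M" "M \<subseteq> entire" and inf: "\<not> (\<exists>F. finite F \<and> cfun.span F = M)"
  obtains y where "y \<in> M" "y \<noteq> 0" "\<And>j. j < N \<Longrightarrow> tcoeff y j = 0"
proof -
  define K where "K N = {y \<in> M. \<forall>j<N. tcoeff y j = 0}" for N
  have sub: "cfun.subspace (K N)" for N
    using M unfolding K_def cfun.subspace_def
    by (auto simp: tcoeff_add tcoeff_cscale subset_iff)
  have KM: "K N \<subseteq> entire" for N using M by (auto simp: K_def)
  have "\<not> (\<exists>F. finite F \<and> cfun.span F = K N)"
  proof (induction N)
    case 0
    then show ?case using inf by (simp add: K_def)
  next
    case (Suc N)
    have K: "K (Suc N) = {y \<in> K N. tcoeff y N = 0}" by (auto simp: K_def less_Suc_eq)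
    show ?case
    proof
      assume "\<exists>F. finite F \<and> cfun.span F = K (Suc N)"
      then obtain F where "finite F" "cfun.span F = {y \<in> K N. tcoeff y N = 0}"
        unfolding K by blast
      then have "\<exists>F. finite F \<and> cfun.span F = K N"
        using KM[of N] by (intro finite_dim_if_kernel_finite_dim[OF sub[of N], of "\<lambda>y. tcoeff y N" F])
          (auto simp: tcoeff_diff tcoeff_cscale subset_iff)
      then show False using Suc by blast
    qed
  qed
  then have "K N \<noteq> {0}" using cfun.span_empty by (metis finite.emptyI)
  moreover have "0 \<in> K N" by (rule cfun.subspace_0[OF sub])
  ultimately show thesis using that unfolding K_def by blast
qed

lemma summable_attains_max:
  fixes a :: "nat \<Rightarrow> real"
  assumes "summable a" "0 < a i"
  obtains J where "\<And>j. a j \<le> a J"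
proof -
  have "eventually (\<lambda>j. a j < a i) sequentially"
    using summable_LIMSEQ_zero[OF assms(1)] assms(2) by (rule order_tendstoD(2))
  then obtain K where K: "\<And>j. K \<le> j \<Longrightarrow> a j < a i"
    unfolding eventually_sequentially by blast
  have "Max (a ` {..max K i}) \<in> a ` {..max K i}" by (intro Max_in) auto
  then obtain J where J: "Max (a ` {..max K i}) = a J" by blast
  have le: "a j \<le> a J" if "j \<le> max K i" for j
    unfolding J[symmetric] using that by (intro Max_ge) auto
  show thesis
  proof (rule that)
    fix j show "a j \<le> a J"
    proof (cases "j \<le> max K i")
      case False
      then have "a j < a i" by (intro K) simp
      then show ?thesis using le[of i] by simp
    qed (rule le)
  qed
qed

text \<open>A nonzero vector of \<open>M\<close> vanishing below \<open>N\<close> is scaled so that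
  its largest weighted coefficient, at \<open>J\<close>, has modulus 1, and is then added to
  \<open>S\<close>.\<close>

lemma subspace_perturbation:
  assumes M: "cfun.subspace M" "M \<subseteq> entire" and inf: "\<not> (\<exists>F. finite F \<and> cfun.span F = M)"
    and S: "S \<in> M" and m: "0 < m"
  obtains S' J where "S' \<in> M" "N \<le> J" "\<And>j. j < N \<Longrightarrow> tcoeff S' j = tcoeff S j"
    "\<And>j. norm (tcoeff S' j - tcoeff S j) * m ^ j \<le> 1" "1 \<le> norm (tcoeff S' J) * m ^ J"
proof -
  obtain y where y: "y \<in> M" "y \<noteq> 0" "\<And>j. j < N \<Longrightarrow> tcoeff y j = 0"
    by (rule exists_vanishing_to_order[OF M inf, where N = N]) (rule that)
  have ent: "y \<in> entire" "S \<in> entire" using M y(1) S by auto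
  define a where "a j = norm (tcoeff y j) * m ^ j" for j
  obtain i where "tcoeff y i \<noteq> 0"
    using entire_eqI[OF ent(1) entire_zero] y(2) by auto
  then have i: "0 < a i" using m by (simp add: a_def)
  obtain J where J: "\<And>j. a j \<le> a J"
    using summable_attains_max[of a i] i summable_tcoeff[OF ent(1), of m] m
    by (auto simp: a_def[abs_def])
  have aJ: "0 < a J" using i J[of i] by linarith
  then have NJ: "N \<le> J" using y(3)[of J] by (force simp: a_def not_le[symmetric])
  \<comment> \<open>The choice of a sign prevents the coefficient that \<open>S\<close> already has
    at \<open>J\<close> from cancelling the new one.\<close>
  have *: "\<exists>\<sigma>. norm \<sigma> = 1 \<and> norm q \<le> norm (p + \<sigma> * q)" for p q :: complex
  proof -
    have "2 * norm q \<le> norm (p + q) + norm (p - q)"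
      using norm_triangle_ineq4[of "p + q" "p - q"] by simp
    then have "norm q \<le> norm (p + 1 * q) \<or> norm q \<le> norm (p + (-1) * q)" by simp linarith
    then show ?thesis by (metis norm_minus_cancel norm_one)
  qed
  obtain \<sigma> where \<sigma>: "norm \<sigma> = 1"
    "norm (tcoeff y J / of_real (a J)) \<le> norm (tcoeff S J + \<sigma> * (tcoeff y J / of_real (a J)))"
    using * by blast
  let ?S' = "S + cscale (\<sigma> / of_real (a J)) y"
  have co: "tcoeff ?S' j = tcoeff S j + \<sigma> / of_real (a J) * tcoeff y j" for j
    by (simp only: tcoeff_add[OF ent(2) entire_cscale[OF ent(1)]] tcoeff_cscale[OF ent(1)])
  show thesis
  proof (rule that[OF _ NJ])
    show "?S' \<in> M" using M(1) S y(1) by (intro cfun.subspace_add cfun.subspace_scale)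
    show "tcoeff ?S' j = tcoeff S j" if "j < N" for j
      unfolding co using y(3)[OF that] by simp
    show "norm (tcoeff ?S' j - tcoeff S j) * m ^ j \<le> 1" for j
    proof -
      have "norm (tcoeff ?S' j - tcoeff S j) * m ^ j = a j / a J"
        unfolding co using aJ \<sigma>(1) by (simp add: norm_mult norm_divide a_def[of j])
      then show ?thesis using J[of j] aJ by simp
    qed
    have "1 = norm (tcoeff y J / of_real (a J)) * m ^ J"
      using aJ by (simp add: norm_divide) (simp add: a_def)
    also have "\<dots> \<le> norm (tcoeff ?S' J) * m ^ J"
      unfolding co using m \<sigma>(2) by (intro mult_right_mono) (auto simp: mult_ac)
    finally show "1 \<le> norm (tcoeff ?S' J) * m ^ J" .
  qed
qed

text \<open>The vector is a limit of successive perturbations; the \<open>s\<close>-th one changes only coefficients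
  beyond \<open>A (s + 1)\<close>, by at most \<open>(s + 2) ^ (- j)\<close>, and makes one of them at least that large.\<close>

lemma slowly_decaying_vector:
  assumes M: "cfun.subspace M" "closedin entire_topology M"
    and inf: "\<not> (\<exists>F. finite F \<and> cfun.span F = M)"
    and A: "\<And>s. s \<le> A s"
  obtains x where "x \<in> M" "\<And>s. \<exists>J\<ge>A (Suc s). 1 \<le> norm (tcoeff x J) * (real s + 2) ^ J"
proof -
  have ME: "M \<subseteq> entire" using closedin_subset[OF M(2)] by simp
  \<comment> \<open>A state pairs the current vector with the index of the coefficient made large
    last; \<open>Q\<close> leaves all coefficients up to that index unchanged.\<close>
  define P where "P x \<longleftrightarrow> fst x \<in> M" for x :: "(complex \<Rightarrow> complex) \<times> nat"
  define Q where "Q s x y \<longleftrightarrow> snd x < snd y \<and> A (Suc s) \<le> snd y \<and>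
      (\<forall>j. j \<le> snd x \<or> j < A (Suc s) \<longrightarrow> tcoeff (fst y) j = tcoeff (fst x) j) \<and>
      (\<forall>j. norm (tcoeff (fst y) j - tcoeff (fst x) j) * (real s + 2) ^ j \<le> 1) \<and>
      1 \<le> norm (tcoeff (fst y) (snd y)) * (real s + 2) ^ snd y"
    for s and x y :: "(complex \<Rightarrow> complex) \<times> nat"
  have "\<exists>y. P y \<and> Q s x y" if x: "P x" for x s
  proof -
    have "0 < real s + 2" by simp
    with x obtain S' J where "S' \<in> M" "max (Suc (snd x)) (A (Suc s)) \<le> J"
      "\<And>j. j < max (Suc (snd x)) (A (Suc s)) \<Longrightarrow> tcoeff S' j = tcoeff (fst x) j"
      "\<And>j. norm (tcoeff S' j - tcoeff (fst x) j) * (real s + 2) ^ j \<le> 1"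
      "1 \<le> norm (tcoeff S' J) * (real s + 2) ^ J"
      unfolding P_def using subspace_perturbation[OF M(1) ME inf] by metis
    then have "P (S', J) \<and> Q s x (S', J)" by (auto simp: P_def Q_def)
    then show ?thesis by blast
  qed
  moreover have "P (0, 0)" by (simp add: P_def cfun.subspace_0[OF M(1)])
  ultimately obtain h where h: "\<And>s. P (h s)" "\<And>s. Q s (h s) (h (Suc s))"
    using dependent_nat_choice[of "\<lambda>_. P" Q] by metis
  define S J where "S s = fst (h s)" and "J s = snd (h s)" for s
  have SM: "S s \<in> M" for s using h(1) by (simp add: P_def S_def)
  have SE: "S s \<in> entire" for s using SM ME by blast
  have JS: "J s < J (Suc s)" "A (Suc s) \<le> J (Suc s)"
    and eq: "\<And>j. j \<le> J s \<or> j < A (Suc s) \<Longrightarrow> tcoeff (S (Suc s)) j = tcoeff (S s) j"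
    and le: "\<And>j. norm (tcoeff (S (Suc s)) j - tcoeff (S s) j) * (real s + 2) ^ j \<le> 1"
    and ge: "1 \<le> norm (tcoeff (S (Suc s)) (J (Suc s))) * (real s + 2) ^ J (Suc s)" for s
    using h(2)[of s] by (auto simp: Q_def S_def J_def)
  have smJ: "strict_mono J" using JS(1) by (simp add: strict_mono_Suc_iff)
  have const: "tcoeff (S t) j = tcoeff (S s) j" if "s \<le> t" "j \<le> J s" for s t j
    using that(1)
  proof (induction rule: dec_induct)
    case (step n)
    have "J s \<le> J n" using smJ step by (simp add: strict_mono_less_eq)
    then show ?case using eq[of j n] that(2) step by simp
  qed simp
  \<comment> \<open>Diagonal limit: since \<open>j <= J j\<close>, the coefficient at
    \<open>j\<close> is constant from stage \<open>j\<close> on.\<close>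
  define a where "a j = tcoeff (S j) j" for j
  have jJ: "j \<le> J j" for j using smJ by (rule strict_mono_imp_increasing)
  have a: "a j = tcoeff (S s) j" if "j \<le> J s" for j s
  proof (cases "s \<le> j")
    case True
    then show ?thesis using const[OF True that] by (simp add: a_def)
  next
    case False
    then show ?thesis using const[of j s j] jJ[of j] by (simp add: a_def)
  qed
  \<comment> \<open>Each of the \<open>t - s\<close> stages changes the coefficient by at most
    \<open>(s + 2) ^ (- j)\<close>. Stage \<open>j\<close> already has the limiting coefficient at
    \<open>j\<close>, so \<open>t = j\<close> yields the factor \<open>j\<close> in
    \<open>g\<close>.\<close>
  have diff: "norm (tcoeff (S t) j - tcoeff (S s) j) * (real s + 2) ^ j \<le> real (t - s)"
    if "s \<le> t" for s t j
    using that
  proof (induction rule: dec_induct)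
    case (step n)
    let ?c = "\<lambda>n. tcoeff (S n) j"
    have "norm (?c (Suc n) - ?c s) \<le> norm (?c (Suc n) - ?c n) + norm (?c n - ?c s)"
      using norm_triangle_ineq[of "?c (Suc n) - ?c n" "?c n - ?c s"] by simp
    then have "norm (?c (Suc n) - ?c s) * (real s + 2) ^ j
        \<le> (norm (?c (Suc n) - ?c n) + norm (?c n - ?c s)) * (real s + 2) ^ j"
      by (rule mult_right_mono) simp
    moreover have "norm (?c (Suc n) - ?c n) * (real s + 2) ^ j \<le> norm (?c (Suc n) - ?c n) * (real n + 2) ^ j"
      using step(1) by (intro mult_left_mono power_mono) auto
    ultimately show ?case
      using step le[of n j] by (simp add: distrib_right Suc_diff_le)
  qed simp
  define g where "g j = real j * (1/2) ^ j" for j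
  have g: "summable g"
  proof -
    have "summable (\<lambda>n. real n * (1/2) ^ (n - 1))"
      using sums_summable[OF geometric_deriv_sums[of "1/2 :: real"]]
      by (subst summable_Suc_iff[symmetric]) simp
    then have "summable (\<lambda>n. 1/2 * (real n * (1/2) ^ (n - 1)))" by (rule summable_mult)
    also have "(\<lambda>n. 1/2 * (real n * (1/2) ^ (n - 1))) = g"
      by (auto simp: g_def fun_eq_iff power_eq_if)
    finally show ?thesis .
  qed
  \<comment> \<open>For \<open>2 * r <= s\<close> the ratio of \<open>r\<close> to
    \<open>s + 2\<close> is at most one half, whence the geometric factor in
    \<open>g\<close>.\<close>
  have tail: "norm (a j - tcoeff (S s) j) * real r ^ j \<le> (if j \<le> s then 0 else g j)"
    if s: "2 * r \<le> s" for j s r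
  proof (cases "j \<le> s")
    case True
    then show ?thesis using a[of j s] jJ[of s] by simp
  next
    case False
    have "norm (a j - tcoeff (S s) j) * (real s + 2) ^ j \<le> real (j - s)"
      using diff[of s j j] False by (simp add: a_def)
    then have *: "norm (a j - tcoeff (S s) j) * (real s + 2) ^ j \<le> real j" by linarith
    have "real r ^ j \<le> ((real s + 2) * (1/2)) ^ j"
      using s by (intro power_mono) auto
    then have "norm (a j - tcoeff (S s) j) * real r ^ j
        \<le> norm (a j - tcoeff (S s) j) * ((real s + 2) * (1/2)) ^ j"
      by (rule mult_left_mono) simp
    also have "\<dots> = (norm (a j - tcoeff (S s) j) * (real s + 2) ^ j) * (1/2) ^ j"
      by (simp only: power_mult_distrib mult.assoc)
    also have "\<dots> \<le> g j" unfolding g_def using * by (rule mult_right_mono) simp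
    finally show ?thesis using False by simp
  qed
  have sm: "summable (\<lambda>j. norm (a j) * real r ^ j)" for r :: nat
  proof (rule summable_comparison_test'[of _ 0])
    show "summable (\<lambda>j. g j + norm (tcoeff (S (2 * r)) j) * real r ^ j)"
      by (intro summable_add g summable_tcoeff SE) simp
    fix j
    have "norm (a j) \<le> norm (a j - tcoeff (S (2 * r)) j) + norm (tcoeff (S (2 * r)) j)"
      using norm_triangle_ineq[of "a j - tcoeff (S (2 * r)) j" "tcoeff (S (2 * r)) j"] by simp
    then have "norm (a j) * real r ^ j \<le>
        norm (a j - tcoeff (S (2 * r)) j) * real r ^ j + norm (tcoeff (S (2 * r)) j) * real r ^ j"
      by (simp add: distrib_right[symmetric] mult_right_mono)
    moreover have "0 \<le> g j" by (simp add: g_def)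
    ultimately show "norm (norm (a j) * real r ^ j) \<le> g j + norm (tcoeff (S (2 * r)) j) * real r ^ j"
      using tail[of r "2 * r" j] by (auto split: if_splits)
  qed
  define x where "x = powser a"
  have x: "x \<in> entire" and cx: "\<And>j. tcoeff x j = a j"
    unfolding x_def using powser_entire[OF sm] by auto
  \<comment> \<open>By the tail estimate the \<open>S s\<close> converge to \<open>x\<close>
    uniformly on discs, and \<open>M\<close> is closed.\<close>
  have "x \<in> M"
  proof (rule ccontr)
    assume "x \<notin> M"
    moreover have "openin entire_topology (entire - M)" using M(2) by (simp add: closedin_def)
    ultimately obtain r :: nat and e where re: "0 < e"
      "\<And>f. f \<in> entire \<Longrightarrow> (\<forall>z. norm z \<le> real r \<longrightarrow> norm (f z - x z) < e) \<Longrightarrow> f \<in> entire - M"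
      using openin_entire_nhd[of "entire - M" x] x by (metis DiffI)
    obtain N where N: "\<And>n. N \<le> n \<Longrightarrow> (\<Sum>i. g (i + n)) < e"
      using suminf_tail_lt[OF g re(1)] by blast
    define s where "s = max N (2 * r)"
    have s: "N \<le> s" "2 * r \<le> s" by (auto simp: s_def)
    let ?k = "\<lambda>j. if j \<le> s then 0 else g j"
    have sk: "summable ?k"
      by (rule summable_comparison_test'[OF g, of 0]) (simp add: g_def)
    have "suminf ?k = (\<Sum>i. ?k (i + Suc s)) + (\<Sum>i<Suc s. ?k i)"
      by (rule suminf_split_initial_segment[OF sk])
    also have "\<dots> = (\<Sum>i. g (i + Suc s))" by simp
    finally have ke: "suminf ?k < e" using N[of "Suc s"] s by simp
    have "norm (S s z - x z) < e" if z: "norm z \<le> real r" for z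
    proof -
      have "norm (tcoeff (S s - x) j) * real r ^ j \<le> ?k j" for j
        using tail[OF s(2), of j] unfolding tcoeff_diff[OF SE x] cx by (simp add: norm_minus_commute)
      then have "norm ((S s - x) z) < e"
        by (intro norm_less_if_tcoeff_le[OF entire_diff[OF SE x] z _ sk ke])
      then show ?thesis by (simp add: fun_diff_def)
    qed
    then have "S s \<in> entire - M" by (intro re(2) SE) blast
    then show False using SM by blast
  qed
  moreover have "\<exists>i\<ge>A (Suc s). 1 \<le> norm (tcoeff x i) * (real s + 2) ^ i" for s
    using JS(2)[of s] ge[of s] a[of "J (Suc s)" "Suc s"] cx by auto
  ultimately show thesis by (rule that)
qed

section \<open>Orbits under the shift and lower bounds for the weights\<close>

context entire_weighted_shift
begin

text \<open>A constant \<open>c\<close> of modulus below 1/2 is chosen away from the finitely many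
  early orbit values at 0. A later orbit member within 1/2 of \<open>c\<close> on the unit disc
  would have all coefficients below 1 by Cauchy's estimate.\<close>

lemma not_hypercyclic_if_slowly_decaying:
  assumes x: "x \<in> entire"
    and n0: "\<And>n. n0 \<le> n \<Longrightarrow> \<exists>k. 1 \<le> norm (tcoeff ((B ^^ n) x) k)"
  shows "\<not> hypercyclic_vector B x"
proof
  assume hyp: "hypercyclic_vector B x"
  define F where "F = (\<lambda>i. (B ^^ i) x 0) ` {..<n0}"
  have "infinite (ball (0::complex) (1/2) - F)"
    by (intro Diff_infinite_finite) (auto simp: F_def uncountable_infinite uncountable_ball)
  then obtain c where c: "norm c < 1/2" "c \<notin> F"
    by (metis Diff_iff dist_0_norm ex_in_conv finite.emptyI mem_ball)
  obtain d where d: "0 < d" "\<And>y. y \<in> F \<Longrightarrow> y \<noteq> c \<Longrightarrow> d \<le> dist c y"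
    using finite_set_avoid[of F c] by (auto simp: F_def)
  have cE: "(\<lambda>z. c) \<in> entire" by (simp add: entire_def)
  have "0 < min d (1/2)" using d(1) by simp
  then obtain n where n: "\<And>z. norm z \<le> 1 \<Longrightarrow> norm ((B ^^ n) x z - c) < min d (1/2)"
    using hypercyclic_vectorD[OF hyp cE, of "min d (1/2)" 1] by metis
  show False
  proof (cases "n < n0")
    case True
    then have "(B ^^ n) x 0 \<in> F" by (simp add: F_def)
    then have "d \<le> dist c ((B ^^ n) x 0)" using d(2) c(2) by metis
    then show False using n[of 0] by (simp add: dist_norm norm_minus_commute)
  next
    case False
    then obtain k where k: "1 \<le> norm (tcoeff ((B ^^ n) x) k)" using n0 by force
    have "norm ((B ^^ n) x z) \<le> norm c + 1/2" if "norm z \<le> 1" for z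
      using n[OF that] norm_triangle_ineq[of "(B ^^ n) x z - c" c] by simp
    then have "norm (tcoeff ((B ^^ n) x) k) * 1 ^ k \<le> norm c + 1/2"
      by (intro norm_tcoeff_le entire_B_pow x) auto
    then show False using k c(1) by simp
  qed
qed

lemma no_hypercyclic_subspace:
  assumes growth: "\<And>m::nat. 2 \<le> m \<Longrightarrow> \<exists>n0. \<forall>n\<ge>n0. \<forall>k. real m ^ (n + k) * norm (W k) \<le> norm (W (n + k))"
  shows "\<not> hypercyclic_subspace B M"
proof
  assume "hypercyclic_subspace B M"
  then have M: "cfun.subspace M" "closedin entire_topology M" "\<not> (\<exists>F. finite F \<and> cfun.span F = M)"
    and hyp: "\<And>x. x \<in> M \<Longrightarrow> x \<noteq> 0 \<Longrightarrow> hypercyclic_vector B x"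
    by (auto simp: hypercyclic_subspace_def)
  have "\<exists>n0. \<forall>n\<ge>n0. \<forall>k. (real s + 2) ^ (n + k) * norm (W k) \<le> norm (W (n + k))" for s
    using growth[of "s + 2"] by (simp add: add.commute)
  then obtain n0 where n0: "\<And>s n k. n0 s \<le> n \<Longrightarrow> (real s + 2) ^ (n + k) * norm (W k) \<le> norm (W (n + k))"
    by metis
  \<comment> \<open>\<open>A s\<close> dominates \<open>n0 s\<close> and \<open>s\<close>, so each
    \<open>n >= A 0\<close> has a last stage \<open>s\<close> with \<open>A s <= n\<close>.\<close>
  define A where "A s = (\<Sum>i\<le>s. n0 i) + s" for s
  have A: "strict_mono A" "n0 s \<le> A s" "s \<le> A s" for s
    by (auto simp: A_def strict_mono_Suc_iff intro: trans_le_add1 member_le_sum)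
  obtain x where x: "x \<in> M" "\<And>s. \<exists>J\<ge>A (Suc s). 1 \<le> norm (tcoeff x J) * (real s + 2) ^ J"
    using slowly_decaying_vector[OF M, of A] A(3) by metis
  have xE: "x \<in> entire" using x(1) closedin_subset[OF M(2)] by auto
  have "x \<noteq> 0" using x(2)[of 0] by auto
  moreover have "\<not> hypercyclic_vector B x"
  proof (rule not_hypercyclic_if_slowly_decaying[OF xE, of "A 0"])
    fix n assume n: "A 0 \<le> n"
    \<comment> \<open>Maximality of \<open>s\<close> puts the index \<open>J >= A (Suc s)\<close> of
      a large coefficient at or beyond \<open>n\<close>, while \<open>n0 s <= n\<close> gives growth
      with the same base \<open>s + 2\<close>, which compensates the decay of that
      coefficient.\<close>
    define s where "s = (GREATEST s. A s \<le> n)"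
    have bd: "\<forall>s. A s \<le> n \<longrightarrow> s \<le> n" using A(3) le_trans by blast
    have s: "A s \<le> n" unfolding s_def using GreatestI_nat[of "\<lambda>s. A s \<le> n" 0 n] n bd by blast
    have max: "t \<le> s" if "A t \<le> n" for t
      unfolding s_def using Greatest_le_nat[of "\<lambda>s. A s \<le> n" t n] that bd by blast
    have "n \<le> A (Suc s)" using max[of "Suc s"] by fastforce
    then obtain J where J: "n \<le> J" "1 \<le> norm (tcoeff x J) * (real s + 2) ^ J"
      using x(2)[of s] order_trans by blast
    have "(real s + 2) ^ J * norm (W (J - n)) \<le> norm (W J)"
      using n0[of s n "J - n"] A(2)[of s] s J(1) by simp
    then have "(real s + 2) ^ J \<le> norm (W J) / norm (W (J - n))" by (simp add: field_simps)
    then have "norm (tcoeff x J) * (real s + 2) ^ J \<le> norm (tcoeff x J) * (norm (W J) / norm (W (J - n)))"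
      by (rule mult_left_mono) simp
    also have "\<dots> = norm (tcoeff ((B ^^ n) x) (J - n))"
      using J(1) by (simp add: tcoeff_B_pow xE norm_mult norm_divide)
    finally show "\<exists>k. 1 \<le> norm (tcoeff ((B ^^ n) x) k)" using J(2) by (meson order_trans)
  qed
  ultimately show False using hyp x(1) by blast
qed

text \<open>The orbit approximates the polynomial with all coefficients \<open>A\<close> up to
  degree \<open>N\<close>, so \<open>W (n + j) / W j\<close> times the coefficient of
  \<open>x\<close> at \<open>n + j\<close> has modulus at least 1. That coefficient is below
  \<open>e / R ^ (n + j)\<close>, which forces the quotient to be large.\<close>

lemma hypercyclic_imp_weights_large:
  assumes "hypercyclic B" "0 < R" "0 < e"
  obtains n where "N \<le> n" "\<And>j. j \<le> N \<Longrightarrow> R ^ (n + j) * norm (W j) \<le> e * norm (W (n + j))"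
proof -
  obtain x where x: "hypercyclic_vector B x" using assms(1) by (auto simp: hypercyclic_def)
  then have xE: "x \<in> entire" by (simp add: hypercyclic_vector_def)
  have "eventually (\<lambda>l. norm (tcoeff x l) * R ^ l < e) sequentially"
    using summable_LIMSEQ_zero[OF summable_tcoeff[OF xE less_imp_le[OF assms(2)]]] assms(3)
    by (rule order_tendstoD(2))
  then obtain n1 where n1: "\<And>l. n1 \<le> l \<Longrightarrow> norm (tcoeff x l) * R ^ l < e"
    unfolding eventually_sequentially by blast
  define n2 where "n2 = max n1 N"
  \<comment> \<open>\<open>A\<close> exceeds the modulus of each early orbit coefficient at 0 by at
    least 2, so an approximation within 1 forces \<open>n2 <= n\<close>.\<close>
  define A where "A = 2 + (\<Sum>i<n2. norm (tcoeff ((B ^^ i) x) 0))"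
  have A2: "2 \<le> A" by (simp add: A_def sum_nonneg)
  define f where "f = powser (\<lambda>j. if j \<le> N then of_real A else 0)"
  have sf: "summable (\<lambda>j. norm (if j \<le> N then of_real A else 0 :: complex) * real r ^ j)" for r
    by (rule summable_finite[of "{..N}"]) auto
  have f: "f \<in> entire" "\<And>j. tcoeff f j = (if j \<le> N then of_real A else 0)"
    unfolding f_def using powser_entire[OF sf] by auto
  obtain n where n: "\<And>z. norm z \<le> 1 \<Longrightarrow> norm ((B ^^ n) x z - f z) < 1"
    using hypercyclic_vectorD[OF x f(1), of 1 1] by (metis zero_less_one)
  have near: "A - 1 \<le> norm (tcoeff ((B ^^ n) x) j)" if "j \<le> N" for j
  proof -
    have "norm (tcoeff ((B ^^ n) x - f) j) * 1 ^ j \<le> 1"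
      using n by (intro norm_tcoeff_le entire_diff entire_B_pow xE f(1)) (auto simp: less_imp_le)
    then have "norm (tcoeff ((B ^^ n) x) j - of_real A) \<le> 1"
      using that unfolding tcoeff_diff[OF entire_B_pow[OF xE] f(1)] f(2) by simp
    moreover have "norm (of_real A :: complex) = A" using A2 by simp
    ultimately show ?thesis
      using norm_triangle_ineq2[of "of_real A" "tcoeff ((B ^^ n) x) j"]
        norm_minus_commute[of "of_real A" "tcoeff ((B ^^ n) x) j"] by linarith
  qed
  have "n2 \<le> n"
  proof (rule ccontr)
    assume "\<not> n2 \<le> n"
    then have "norm (tcoeff ((B ^^ n) x) 0) \<le> (\<Sum>i<n2. norm (tcoeff ((B ^^ i) x) 0))"
      by (intro member_le_sum) auto
    then show False using near[of 0] by (simp add: A_def)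
  qed
  show thesis
  proof (rule that)
    show "N \<le> n" using \<open>n2 \<le> n\<close> by (simp add: n2_def)
    fix j assume j: "j \<le> N"
    let ?c = "norm (tcoeff x (n + j))"
    have "A - 1 \<le> norm (W (n + j)) / norm (W j) * ?c"
      using near[OF j] by (simp add: tcoeff_B_pow xE norm_mult norm_divide)
    then have "1 \<le> norm (W (n + j)) / norm (W j) * ?c" using A2 by linarith
    then have "norm (W j) \<le> norm (W (n + j)) * ?c" by (simp add: field_simps)
    then have "R ^ (n + j) * norm (W j) \<le> R ^ (n + j) * (norm (W (n + j)) * ?c)"
      using assms(2) by (intro mult_left_mono) auto
    also have "\<dots> = norm (W (n + j)) * (?c * R ^ (n + j))" by simp
    also have "\<dots> \<le> norm (W (n + j)) * e"
      using n1[of "n + j"] \<open>n2 \<le> n\<close> by (intro mult_left_mono) (auto simp: n2_def less_imp_le)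
    finally show "R ^ (n + j) * norm (W j) \<le> e * norm (W (n + j))" by (simp add: mult.commute)
  qed
qed

end

section \<open>Construction of a hypercyclic subspace\<close>

lemma complex_dense_sequence:
  obtains c :: "nat \<Rightarrow> complex" where "\<And>x e. 0 < e \<Longrightarrow> \<exists>n. norm (c n - x) < e"
proof -
  obtain D :: "complex set" where D: "countable D" "\<And>U. open U \<Longrightarrow> U \<noteq> {} \<Longrightarrow> \<exists>y\<in>D. y \<in> U"
    using countable_dense_exists by blast
  have "D \<noteq> {}" using D(2)[of UNIV] by auto
  have "\<exists>n. norm (from_nat_into D n - x) < e" if "0 < e" for x e
  proof -
    obtain y where "y \<in> D" "y \<in> ball x e" using D(2)[of "ball x e"] \<open>0 < e\<close> by auto
    moreover then obtain n where "from_nat_into D n = y" using from_nat_into_surj[OF D(1)] by blast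
    ultimately show ?thesis by (auto simp: dist_norm norm_minus_commute)
  qed
  then show thesis by (rule that)
qed

text \<open>Each \<open>k\<close> encodes a label, a dummy counter and a list of positions in a
  dense sequence of scalars; the counter makes every labelled polynomial recur beyond any
  \<open>k0\<close>.\<close>

lemma dense_labelled_polynomials:
  obtains i d :: "nat \<Rightarrow> nat" and q :: "nat \<Rightarrow> nat \<Rightarrow> complex" where
    "\<And>k j. d k < j \<Longrightarrow> q k j = 0"
    "\<And>i0 k0 f e r. \<lbrakk>f \<in> entire; 0 < e; 0 \<le> r\<rbrakk> \<Longrightarrow>
      \<exists>k\<ge>k0. i k = i0 \<and> (\<forall>z. norm z \<le> r \<longrightarrow> norm (powser (q k) z - f z) < e)"
proof -
  obtain c :: "nat \<Rightarrow> complex" where c: "\<And>x e. 0 < e \<Longrightarrow> \<exists>n. norm (c n - x) < e"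
    using complex_dense_sequence by blast
  define lab where "lab k = (from_nat k :: nat \<times> nat \<times> nat list)" for k
  define i where "i k = fst (lab k)" for k
  define ls where "ls k = snd (snd (lab k))" for k
  define q where "q k j = (if j < length (ls k) then c (ls k ! j) else 0)" for k j
  show thesis
  proof (rule that[of "\<lambda>k. length (ls k)" q i])
    show "q k j = 0" if "length (ls k) < j" for k j using that by (simp add: q_def)
    fix i0 k0 :: nat and f and e r :: real assume f: "f \<in> entire" and e: "0 < e" and r: "0 \<le> r"
    obtain N where N: "\<And>z. norm z \<le> r \<Longrightarrow> norm (f z - taylor_sum f N z) < e / 2"
      using taylor_sum_approx[OF f r, of "e / 2"] e by (metis half_gt_zero order_refl)
    \<comment> \<open>Errors below \<open>\<delta>\<close> in all coefficients add up to at most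
      \<open>e / 2\<close> on the disc; the summand 1 keeps the denominator positive.\<close>
    define \<delta> where "\<delta> = e / 2 / (1 + (\<Sum>j<N. r ^ j))"
    have s0: "0 \<le> (\<Sum>j<N. r ^ j)" using r by (intro sum_nonneg) simp
    then have \<delta>: "0 < \<delta>" using e by (simp add: \<delta>_def)
    have \<delta>s: "(\<Sum>j<N. \<delta> * r ^ j) \<le> e / 2"
    proof -
      have "(\<Sum>j<N. \<delta> * r ^ j) = \<delta> * (\<Sum>j<N. r ^ j)" by (simp add: sum_distrib_left)
      also have "\<dots> \<le> \<delta> * (1 + (\<Sum>j<N. r ^ j))" using \<delta> by (intro mult_left_mono) auto
      also have "\<dots> = e / 2" unfolding \<delta>_def using s0 by (intro nonzero_eq_divide_eq[THEN iffD1] refl) simp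
      finally show ?thesis .
    qed
    obtain g where g: "\<And>j. norm (c (g j) - tcoeff f j) < \<delta>"
      using choice[of "\<lambda>j n. norm (c n - tcoeff f j) < \<delta>"] c[OF \<delta>] by blast
    define l where "l = map g [0..<N]"
    have "inj (\<lambda>t. to_nat (i0, t :: nat, l))" by (intro injI) simp
    then have "infinite (range (\<lambda>t. to_nat (i0, t :: nat, l)))" by (rule range_inj_infinite)
    then obtain t where t: "k0 \<le> to_nat (i0, t :: nat, l)"
      unfolding infinite_nat_iff_unbounded_le by blast
    define k where "k = to_nat (i0, t :: nat, l)"
    have k: "i k = i0" "ls k = l" by (simp_all add: i_def ls_def lab_def k_def)
    have "norm (powser (q k) z - f z) < e" if z: "norm z \<le> r" for z
    proof -
      have "powser (q k) z = (\<Sum>j<N. c (g j) * z ^ j)"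
        unfolding powser_def by (subst suminf_finite[of "{..<N}"]) (auto simp: q_def k l_def)
      moreover have "taylor_sum f N z = (\<Sum>j<N. tcoeff f j * z ^ j)"
        by (induction N) (simp_all add: taylor_sum_def cscale_def)
      ultimately have "norm (powser (q k) z - taylor_sum f N z) = norm (\<Sum>j<N. (c (g j) - tcoeff f j) * z ^ j)"
        by (simp add: sum_subtractf left_diff_distrib)
      also have "\<dots> \<le> (\<Sum>j<N. \<delta> * r ^ j)"
        using z r \<delta> less_imp_le[OF g] by (intro sum_norm_le)
          (auto simp: norm_mult norm_power intro!: mult_mono power_mono)
      finally have "norm (powser (q k) z - taylor_sum f N z) \<le> e / 2" using \<delta>s by linarith
      then show ?thesis
        using N[OF z] norm_triangle_ineq[of "powser (q k) z - taylor_sum f N z" "taylor_sum f N z - f z"]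
        by (simp add: norm_minus_commute)
    qed
    moreover have "k0 \<le> k" using t by (simp add: k_def)
    ultimately show "\<exists>k\<ge>k0. i k = i0 \<and> (\<forall>z. norm z \<le> r \<longrightarrow> norm (powser (q k) z - f z) < e)"
      using k(1) by (intro exI[of _ k]) simp
  qed
qed

section \<open>Closed subspaces given by relations between Taylor coefficients\<close>

definition coeff_relations :: "(nat \<times> complex \<times> nat) set \<Rightarrow> (complex \<Rightarrow> complex) set" where
  "coeff_relations R = {x \<in> entire. \<forall>(l, c, l') \<in> R. tcoeff x l = c * tcoeff x l'}"

lemma subspace_coeff_relations: "cfun.subspace (coeff_relations R)"
  unfolding cfun.subspace_def coeff_relations_def
  by (fastforce simp: entire_zero entire_add entire_cscale tcoeff_add tcoeff_cscale algebra_simps)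

text \<open>By Cauchy's estimate on the unit disc the coefficients depend continuously on the
  function, so a violated relation stays violated nearby.\<close>

lemma closedin_coeff_relations: "closedin entire_topology (coeff_relations R)"
  unfolding closedin_def
proof
  show "coeff_relations R \<subseteq> topspace entire_topology" by (auto simp: coeff_relations_def)
  show "openin entire_topology (topspace entire_topology - coeff_relations R)"
    unfolding openin_entire_topology topspace_entire_topology
  proof (intro conjI ballI)
    fix x assume "x \<in> entire - coeff_relations R"
    then obtain l c l' where x: "x \<in> entire" and R: "(l, c, l') \<in> R"
      and ne: "tcoeff x l \<noteq> c * tcoeff x l'"
      by (auto simp: coeff_relations_def)
    \<comment> \<open>A change of both coefficients by at most \<open>\<eta>\<close> alters the
      defect by at most half of it.\<close>
    define \<eta> where "\<eta> = norm (tcoeff x l - c * tcoeff x l') / 2 / (1 + norm c)"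
    have c1: "0 < 1 + norm c" by (simp add: add_pos_nonneg)
    have \<eta>: "0 < \<eta>" using ne c1 by (simp add: \<eta>_def)
    show "\<exists>K e. compact K \<and> 0 < e \<and>
      (\<forall>g\<in>entire. (\<forall>z\<in>K. dist (g z) (x z) < e) \<longrightarrow> g \<in> entire - coeff_relations R)"
    proof (intro exI[of _ "cball 0 1"] exI[of _ \<eta>] conjI ballI impI)
      fix g assume g: "g \<in> entire" "\<forall>z\<in>cball 0 1. dist (g z) (x z) < \<eta>"
      have near: "norm (tcoeff x j - tcoeff g j) \<le> \<eta>" for j
      proof -
        have "norm (tcoeff (x - g) j) * 1 ^ j \<le> \<eta>"
          using g(2) by (intro norm_tcoeff_le entire_diff x g(1))
            (auto simp: dist_norm norm_minus_commute less_imp_le)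
        then show ?thesis unfolding tcoeff_diff[OF x g(1)] by simp
      qed
      have "tcoeff g l \<noteq> c * tcoeff g l'"
      proof
        assume "tcoeff g l = c * tcoeff g l'"
        then have "tcoeff x l - c * tcoeff x l' = (tcoeff x l - tcoeff g l) - c * (tcoeff x l' - tcoeff g l')"
          by (simp add: algebra_simps)
        then have "norm (tcoeff x l - c * tcoeff x l')
            \<le> norm (tcoeff x l - tcoeff g l) + norm c * norm (tcoeff x l' - tcoeff g l')"
          by (metis norm_mult norm_triangle_ineq4)
        also have "\<dots> \<le> \<eta> + norm c * \<eta>" by (intro add_mono mult_left_mono near) simp
        also have "\<dots> = \<eta> * (1 + norm c)" by (simp add: algebra_simps)
        also have "\<dots> = norm (tcoeff x l - c * tcoeff x l') / 2"
          unfolding \<eta>_def using c1 by (intro nonzero_eq_divide_eq[THEN iffD1] refl) simp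
        finally show False using ne by simp
      qed
      then show "g \<in> entire - coeff_relations R"
        using g(1) R by (force simp: coeff_relations_def)
    qed (use \<eta> in auto)
  qed auto
qed

text \<open>The coefficient at \<open>P t\<close> vanishes on the span of the other members but not
  at \<open>u t\<close>, so the family is independent.\<close>

lemma not_finite_dim_if_dual_family:
  assumes M: "M \<subseteq> entire"
    and u: "\<And>t. u t \<in> M" "\<And>s t :: nat. tcoeff (u t) (P s) = (if s = t then 1 else 0)"
  shows "\<not> (\<exists>F. finite F \<and> cfun.span F = M)"
proof
  assume "\<exists>F. finite F \<and> cfun.span F = M"
  then obtain F where F: "finite F" "cfun.span F = M" by blast
  have "inj u" by (intro injI) (metis u(2) zero_neq_one)
  have "cfun.independent (range u)"
    unfolding cfun.dependent_def
  proof
    assume "\<exists>a\<in>range u. a \<in> cfun.span (range u - {a})"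
    then obtain t where t: "u t \<in> cfun.span (range u - {u t})" by blast
    have "cfun.span (range u - {u t}) \<subseteq> coeff_relations {(P t, 0, 0)}"
      using M u by (intro cfun.span_minimal subspace_coeff_relations) (auto simp: coeff_relations_def)
    with t have "tcoeff (u t) (P t) = 0" by (auto simp: coeff_relations_def)
    then show False using u(2) by simp
  qed
  moreover have "range u \<subseteq> cfun.span F" using F(2) u(1) by auto
  ultimately have "finite (range u)" using cfun.independent_span_bound[OF F(1)] by blast
  then show False using \<open>inj u\<close> range_inj_infinite by blast
qed

section \<open>Blocks and free coefficients\<close>

context entire_weighted_shift
begin

text \<open>Each of the \<open>s\<close> additional factors has index at most \<open>l + s\<close>,
  hence modulus at most \<open>C ^ (l + s)\<close>.\<close>

lemma W_growth_bound:
  assumes C: "1 \<le> C" "\<And>n. 1 \<le> n \<Longrightarrow> norm (w n) \<le> C ^ n"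
  shows "norm (W (l + s)) \<le> C ^ ((l + s) * s) * norm (W l)"
proof (induction s)
  case (Suc s)
  have "norm (W (l + Suc s)) = norm (w (Suc (l + s))) * norm (W (l + s))"
    by (simp add: W_Suc norm_mult)
  also have "\<dots> \<le> C ^ Suc (l + s) * (C ^ ((l + s) * s) * norm (W l))"
    using C(2)[of "Suc (l + s)"] C(1) Suc by (intro mult_mono) auto
  also have "\<dots> = C ^ (Suc (l + s) + (l + s) * s) * norm (W l)"
    by (simp only: power_add mult.assoc)
  also have "\<dots> \<le> C ^ ((l + Suc s) * Suc s) * norm (W l)"
    using C(1) by (intro mult_right_mono power_increasing) auto
  finally show ?case .
qed simp

end

text \<open>Block \<open>k\<close> occupies the indices \<open>n k .. n k + d k\<close> and carries the preimage of the polynomial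
  \<open>q k\<close> under the \<open>n k\<close>-th power of the operator; the free coefficients sit at \<open>p 1, p 2, \<dots>\<close>, and
  the coefficient at \<open>p (i k + 1)\<close> scales block \<open>k\<close>.\<close>

locale block_construction = entire_weighted_shift +
  fixes C M :: real and i d p n :: "nat \<Rightarrow> nat" and q :: "nat \<Rightarrow> nat \<Rightarrow> complex"
  assumes C: "1 \<le> C" "\<And>n. 1 \<le> n \<Longrightarrow> norm (w n) \<le> C ^ n"
    and M: "1 \<le> M"
    and q_zero: "\<And>k j. d k < j \<Longrightarrow> q k j = 0"
    and q_dense: "\<And>i0 k0 f e r. \<lbrakk>f \<in> entire; 0 < e; 0 \<le> r\<rbrakk> \<Longrightarrow>
      \<exists>k\<ge>k0. i k = i0 \<and> (\<forall>z. norm z \<le> r \<longrightarrow> norm (powser (q k) z - f z) < e)"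
    and p_0: "p 0 = 0" and p_less_n: "\<And>k. p k < n k" and n_less_p: "\<And>k. n k + d k < p (Suc k)"
    and small: "\<And>k j. j \<le> d k \<Longrightarrow>
      norm (q k j) * ((2 * (real k + 1) * C ^ p k) ^ (n k + j) * norm (W j)) \<le> norm (W (n k + j))"
    and bounded: "\<And>k l. l \<le> n k \<Longrightarrow>
      norm (W (p (Suc k))) \<le> M ^ p (Suc k) * norm (W (p (Suc k) - l))"
begin

lemma p_strict_mono: "strict_mono p"
  unfolding strict_mono_Suc_iff using p_less_n n_less_p by (metis add_lessD1 less_trans)

lemma n_strict_mono: "strict_mono n"
  unfolding strict_mono_Suc_iff using p_less_n n_less_p by (metis add_lessD1 less_trans)

lemma le_p: "k \<le> p k" and le_n: "k \<le> n k"
  using p_strict_mono n_strict_mono by (simp_all add: strict_mono_imp_increasing)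

text \<open>The windows from \<open>p k + 1\<close> to \<open>p (Suc k)\<close> partition the
  positive indices, each holding block \<open>k\<close> and ending at a free index; this locates the
  window of \<open>l\<close>.\<close>

definition blk :: "nat \<Rightarrow> nat" where
  "blk l = (LEAST k. l \<le> p (Suc k))"

lemma blk_eqI: "p k < l \<Longrightarrow> l \<le> p (Suc k) \<Longrightarrow> blk l = k"
  unfolding blk_def
proof (rule Least_equality)
  fix k' assume "p k < l" "l \<le> p (Suc k')"
  then have "p k < p (Suc k')" by linarith
  then show "k \<le> k'" using p_strict_mono by (simp add: strict_mono_less)
qed

lemma blk_block: "j \<le> d k \<Longrightarrow> blk (n k + j) = k"
  using p_less_n[of k] n_less_p[of k] by (intro blk_eqI) auto

lemma blk_p: "blk (p (Suc k)) = k"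
  using p_strict_mono by (intro blk_eqI) (auto simp: strict_mono_less)

lemma le_p_blk: "l \<le> p (Suc (blk l))"
  unfolding blk_def by (rule LeastI[of _ l]) (use le_p[of "Suc l"] in simp)

text \<open>The factor inverts the one in \<open>tcoeff_B_pow\<close>: \<open>B ^^ n k\<close> turns
  this coefficient at \<open>n k + j\<close> into \<open>q k j\<close> at \<open>j\<close>.\<close>

definition block_coeff :: "nat \<Rightarrow> nat \<Rightarrow> complex" where
  "block_coeff k j = q k j * W j / W (n k + j)"

lemma norm_block_coeff_le:
  assumes "j \<le> d k"
  shows "norm (block_coeff k j) * (2 * (real k + 1) * C ^ p k) ^ (n k + j) \<le> 1"
  using small[OF assms] by (simp add: block_coeff_def norm_mult norm_divide divide_le_eq mult_ac)

definition free_or_block :: "nat set" where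
  "free_or_block = range (\<lambda>s. p (Suc s)) \<union> {n k + j |k j. j \<le> d k}"

definition block_rels :: "(nat \<times> complex \<times> nat) set" where
  "block_rels = {(n k + j, block_coeff k j, p (Suc (i k))) |k j. j \<le> d k} \<union> {(l, 0, 0) |l. l \<notin> free_or_block}"

abbreviation block_space :: "(complex \<Rightarrow> complex) set" where
  "block_space \<equiv> coeff_relations block_rels"

lemma block_space_iff:
  "x \<in> block_space \<longleftrightarrow> x \<in> entire \<and> (\<forall>k j. j \<le> d k \<longrightarrow> tcoeff x (n k + j) = block_coeff k j * tcoeff x (p (Suc (i k)))) \<and>
    (\<forall>l. l \<notin> free_or_block \<longrightarrow> tcoeff x l = 0)"
  unfolding coeff_relations_def block_rels_def by (simp add: ball_Un) blast

text \<open>These are the coefficients of the member of \<open>block_space\<close> whose only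
  nonzero free coefficient is a 1 at \<open>p (Suc t)\<close>; such members witness infinite
  dimension.\<close>

definition gen_coeff :: "nat \<Rightarrow> nat \<Rightarrow> complex" where
  "gen_coeff t l = (let k = blk l in
     if l = p (Suc k) then (if k = t then 1 else 0)
     else if i k = t \<and> n k \<le> l \<and> l \<le> n k + d k then block_coeff k (l - n k) else 0)"

lemma gen_coeff_p: "gen_coeff t (p (Suc s)) = (if s = t then 1 else 0)"
  by (simp add: gen_coeff_def blk_p)

lemma gen_coeff_block: "j \<le> d k \<Longrightarrow> gen_coeff t (n k + j) = (if i k = t then block_coeff k j else 0)"
  using n_less_p[of k] by (simp add: gen_coeff_def blk_block)

lemma gen_coeff_other: "l \<notin> free_or_block \<Longrightarrow> gen_coeff t l = 0"
proof -
  assume l: "l \<notin> free_or_block"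
  then have "l \<noteq> p (Suc (blk l))" by (auto simp: free_or_block_def)
  moreover have "\<not> (n (blk l) \<le> l \<and> l \<le> n (blk l) + d (blk l))"
  proof
    assume "n (blk l) \<le> l \<and> l \<le> n (blk l) + d (blk l)"
    then have "l = n (blk l) + (l - n (blk l))" "l - n (blk l) \<le> d (blk l)" by auto
    then show False using l unfolding free_or_block_def by blast
  qed
  ultimately show ?thesis by (auto simp: gen_coeff_def Let_def)
qed

lemma summable_gen_coeff: "summable (\<lambda>l. norm (gen_coeff t l) * real r ^ l)"
\<comment> \<open>Past this threshold the free coefficients are 0 and the blocks have number at
  least \<open>r\<close>, so \<open>norm_block_coeff_le\<close> yields
  \<open>(1/2) ^ l\<close>.\<close>
proof (rule summable_comparison_test'[of "\<lambda>l. (1/2) ^ l" "p (Suc t) + p r + 1"])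
  show "summable (\<lambda>l. (1/2 :: real) ^ l)" by (rule summable_geometric) simp
  fix l assume l: "p (Suc t) + p r + 1 \<le> l"
  define k where "k = blk l"
  have "p r < p (Suc k)" using l le_p_blk[of l] by (simp add: k_def)
  then have rk: "r \<le> k" using p_strict_mono by (simp add: strict_mono_less)
  show "norm (norm (gen_coeff t l) * real r ^ l) \<le> (1/2) ^ l"
  proof (cases "l \<noteq> p (Suc k) \<and> n k \<le> l \<and> l \<le> n k + d k")
    case True
    then obtain j where j: "l = n k + j" "j \<le> d k" by (auto simp: le_iff_add)
    have "norm (gen_coeff t l) \<le> norm (block_coeff k j)" using j by (simp add: gen_coeff_block)
    then have "norm (gen_coeff t l) * (2 * real r) ^ l \<le> norm (block_coeff k j) * (2 * (real k + 1) * C ^ p k) ^ l"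
    proof (rule mult_mono[OF _ power_mono])
      have "2 * real r * 1 \<le> 2 * (real k + 1) * C ^ p k"
        using rk C(1) by (intro mult_mono) auto
      then show "2 * real r \<le> 2 * (real k + 1) * C ^ p k" by simp
    qed auto
    also have "\<dots> \<le> 1" using norm_block_coeff_le[OF j(2)] j(1) by simp
    finally show ?thesis by (simp add: power_mult_distrib field_simps)
  next
    case False
    have "gen_coeff t l = 0"
    proof (cases "l = p (Suc k)")
      case True
      then have "k \<noteq> t" using l by auto
      then show ?thesis using True by (simp add: gen_coeff_p)
    next
      case ne: False
      then show ?thesis using False by (auto simp: gen_coeff_def Let_def k_def[symmetric])
    qed
    then show ?thesis by simp
  qed
qed

lemma block_space_infinite_dim: "\<not> (\<exists>F. finite F \<and> cfun.span F = block_space)"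
proof (rule not_finite_dim_if_dual_family[of _ "\<lambda>t. powser (gen_coeff t)" "\<lambda>s. p (Suc s)"])
  show "block_space \<subseteq> entire" by (auto simp: coeff_relations_def)
  note u = powser_entire[OF summable_gen_coeff]
  show "powser (gen_coeff t) \<in> block_space" for t
    unfolding block_space_iff using u by (auto simp: gen_coeff_block gen_coeff_p gen_coeff_other)
  show "tcoeff (powser (gen_coeff t)) (p (Suc s)) = (if s = t then 1 else 0)" for s t
    using u by (simp add: gen_coeff_p)
qed

text \<open>At a free index \<open>p (Suc s)\<close> beyond block \<open>k\<close>,
  \<open>bounded\<close> applies since \<open>n k <= n s\<close>. In a later block
  \<open>k'\<close>, the crude growth \<open>C ^ (l * n k)\<close> is paid by the factor
  \<open>C ^ p k'\<close> built into \<open>small\<close>, as \<open>n k <= p k'\<close>, and the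
  factor 2 there leaves \<open>(1/2) ^ l\<close>.\<close>

lemma block_estimate:
  assumes x: "x \<in> block_space" and A: "\<And>l. norm (tcoeff x l) \<le> A"
    and r: "1 \<le> r" "r \<le> k" and l: "n k + d k < l"
  shows "norm (W l / W (l - n k) * tcoeff x l) * real r ^ (l - n k)
    \<le> A * (1/2) ^ l + norm (tcoeff x l) * (M * real r) ^ l" (is "?L \<le> ?R1 + ?R2")
proof -
  have A0: "0 \<le> A" using A[of 0] norm_ge_zero order_trans by blast
  have R: "0 \<le> ?R1" "0 \<le> ?R2" using A0 M by simp_all
  have rl: "real r ^ (l - n k) \<le> real r ^ l" using r by (intro power_increasing) auto
  consider s where "l = p (Suc s)" | k' j where "l = n k' + j" "j \<le> d k'" | "l \<notin> free_or_block"
    unfolding free_or_block_def by auto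
  then show ?thesis
  proof cases
    case (1 s)
    have "k \<le> s"
    proof (rule ccontr)
      assume "\<not> k \<le> s"
      then have "p (Suc s) \<le> p k" using p_strict_mono by (simp add: strict_mono_less_eq)
      then show False using 1 l p_less_n[of k] by linarith
    qed
    then have "n k \<le> n s" using n_strict_mono by (simp add: strict_mono_less_eq)
    then have "norm (W l) \<le> M ^ l * norm (W (l - n k))" using bounded 1 by blast
    then have "norm (W l) / norm (W (l - n k)) \<le> M ^ l" by (simp add: divide_le_eq)
    then have "?L \<le> M ^ l * norm (tcoeff x l) * real r ^ l"
      unfolding norm_mult norm_divide using M by (intro mult_mono rl) auto
    also have "\<dots> = ?R2" by (simp add: power_mult_distrib)
    finally show ?thesis using R by linarith
  next
    case (2 k' j)
    have "k < k'"
    proof (rule ccontr)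
      assume "\<not> k < k'"
      then consider "k' = k" | "Suc k' \<le> k" by linarith
      then show False
      proof cases
        case 2
        then have "p (Suc k') \<le> p k" using p_strict_mono by (simp add: strict_mono_less_eq)
        then show False using \<open>l = n k' + j\<close> \<open>j \<le> d k'\<close> l p_less_n[of k] n_less_p[of k'] by linarith
      qed (use 2 l in auto)
    qed
    then have "p (Suc k) \<le> p k'" using p_strict_mono by (simp add: strict_mono_less_eq)
    then have nk: "n k \<le> p k'" using n_less_p[of k] by linarith
    have "norm (W (l - n k + n k)) \<le> C ^ ((l - n k + n k) * n k) * norm (W (l - n k))"
      by (rule W_growth_bound[OF C])
    then have "norm (W l) / norm (W (l - n k)) \<le> C ^ (l * n k)"
      using l by (simp add: divide_le_eq)
    also have "\<dots> \<le> C ^ (l * p k')" using nk C(1) by (intro power_increasing) auto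
    finally have Wle: "norm (W l) / norm (W (l - n k)) \<le> (C ^ p k') ^ l"
      by (simp add: power_mult[symmetric] mult.commute)
    have "norm (tcoeff x l) = norm (block_coeff k' j) * norm (tcoeff x (p (Suc (i k'))))"
      using x 2 by (simp add: block_space_iff norm_mult)
    also have "\<dots> \<le> norm (block_coeff k' j) * A" by (intro mult_left_mono A) simp
    finally have "?L \<le> (C ^ p k') ^ l * (norm (block_coeff k' j) * A) * (real k' + 1) ^ l"
      unfolding norm_mult norm_divide
    proof (intro mult_mono Wle)
      show "real r ^ (l - n k) \<le> (real k' + 1) ^ l"
        using r \<open>k < k'\<close> by (intro order_trans[OF rl] power_mono) auto
    qed (use C(1) A0 in auto)
    also have "\<dots> = A * (norm (block_coeff k' j) * ((real k' + 1) * C ^ p k') ^ l)"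
      by (simp add: power_mult_distrib)
    also have "\<dots> \<le> A * (1/2) ^ l"
    proof (intro mult_left_mono A0)
      have "(2 * (real k' + 1) * C ^ p k') ^ l = 2 ^ l * ((real k' + 1) * C ^ p k') ^ l"
        by (simp only: power_mult_distrib mult.assoc)
      then have "2 ^ l * (norm (block_coeff k' j) * ((real k' + 1) * C ^ p k') ^ l) \<le> 1"
        using norm_block_coeff_le[OF 2(2)] 2(1) by (simp add: mult.left_commute)
      then show "norm (block_coeff k' j) * ((real k' + 1) * C ^ p k') ^ l \<le> (1/2) ^ l"
        by (simp add: power_divide pos_le_divide_eq mult.commute)
    qed
    finally show ?thesis using R by linarith
  next
    case 3
    then have "tcoeff x l = 0" using x by (simp add: block_space_iff)
    then show ?thesis using R by simp
  qed
qed

text \<open>The free coefficients determine all others, so some free coefficient \<open>a\<close> is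
  nonzero. Among the polynomials whose blocks it scales, arbitrarily late ones approximate
  \<open>f / a\<close>; the error from the rest of \<open>x\<close> is a tail of
  \<open>G\<close>.\<close>

lemma block_space_hypercyclic:
  assumes x: "x \<in> block_space" and "x \<noteq> 0"
  shows "hypercyclic_vector B x"
proof -
  have xE: "x \<in> entire" using x by (simp add: block_space_iff)
  have "\<exists>s. tcoeff x (p (Suc s)) \<noteq> 0"
  proof (rule ccontr)
    assume none: "\<nexists>s. tcoeff x (p (Suc s)) \<noteq> 0"
    have "tcoeff x l = 0" for l
    proof (cases "l \<in> free_or_block")
      case True
      then show ?thesis using x none by (auto simp: free_or_block_def block_space_iff)
    qed (use x in \<open>auto simp: block_space_iff\<close>)
    then have "x = 0" by (intro entire_eqI[OF xE entire_zero]) simp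
    then show False using assms(2) by simp
  qed
  then obtain s where s: "tcoeff x (p (Suc s)) \<noteq> 0" ..
  define a where "a = tcoeff x (p (Suc s))"
  have a: "a \<noteq> 0" using s by (simp add: a_def)
  define A where "A = (\<Sum>j. norm (tcoeff x j) * 1 ^ j)"
  have A: "norm (tcoeff x l) \<le> A" for l
  proof -
    have "norm (tcoeff x l) * 1 ^ l \<le> A"
      using norm_le_suminf_tcoeff[OF xE, of _ 1] by (intro norm_tcoeff_le[OF xE]) (auto simp: A_def)
    then show ?thesis by simp
  qed
  show ?thesis
  proof (rule hypercyclic_vectorI[OF xE entire_B_pow[OF xE]])
    fix f and e :: real and r0 :: nat assume f: "f \<in> entire" and e: "0 < e"
    define r where "r = Suc r0"
    have r: "1 \<le> r" "r0 \<le> r" by (auto simp: r_def)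
    define G where "G l = A * (1/2) ^ l + norm (tcoeff x l) * (M * real r) ^ l" for l
    have G: "summable G" unfolding G_def
      using M by (intro summable_add summable_mult summable_tcoeff[OF xE] summable_geometric) auto
    have G0: "0 \<le> G l" for l
      using M order_trans[OF norm_ge_zero A] by (simp add: G_def)
    obtain K where K: "\<And>m. K \<le> m \<Longrightarrow> (\<Sum>l. G (l + m)) < e / 2"
      using suminf_tail_lt[OF G half_gt_zero[OF e]] by blast
    have fa: "cscale (1 / a) f \<in> entire" by (rule entire_cscale[OF f])
    have ea: "0 < e / (2 * norm a)" using e a by simp
    obtain k where k: "max K r \<le> k" "i k = s"
      "\<And>z. norm z \<le> real r \<Longrightarrow> norm (powser (q k) z - cscale (1 / a) f z) < e / (2 * norm a)"
      using q_dense[OF fa ea, of "real r" "max K r" s] by auto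
    have qs: "summable (\<lambda>j. norm (q k j) * real r ^ j)" for r :: nat
      by (rule summable_finite[of "{..d k}"]) (auto simp: q_zero)
    note qE = powser_entire[OF qs]
    let ?D = "(B ^^ n k) x - cscale a (powser (q k))"
    have D: "?D \<in> entire" by (intro entire_diff entire_B_pow xE entire_cscale qE(1))
    have cD: "tcoeff ?D j = W (n k + j) / W j * tcoeff x (n k + j) - a * q k j" for j
      by (simp only: tcoeff_diff[OF entire_B_pow[OF xE] entire_cscale[OF qE(1)]]
          tcoeff_B_pow[OF xE] tcoeff_cscale[OF qE(1)] qE(2))
    \<comment> \<open>On the block the coefficients agree exactly; beyond it
      \<open>block_estimate\<close> applies.\<close>
    have Dle: "norm (tcoeff ?D j) * real r ^ j \<le> G (j + n k)" for j
    proof (cases "j \<le> d k")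
      case True
      have "tcoeff x (n k + j) = block_coeff k j * a" using x True k(2) by (simp add: block_space_iff a_def)
      then have "tcoeff ?D j = 0" unfolding cD by (simp add: block_coeff_def)
      then show ?thesis using G0 by simp
    next
      case False
      then have "norm (W (n k + j) / W (n k + j - n k) * tcoeff x (n k + j)) * real r ^ (n k + j - n k) \<le> G (n k + j)"
        unfolding G_def using k(1) r(1) by (intro block_estimate[OF x A]) auto
      then show ?thesis unfolding cD using q_zero[of k j] False by (simp add: add.commute)
    qed
    have sD: "summable (\<lambda>j. G (j + n k))" using G by (rule summable_ignore_initial_segment)
    have "K \<le> n k" using k(1) le_n[of k] by simp
    have close: "norm ((B ^^ n k) x z - f z) < e" if z: "norm z \<le> real r" for z
    proof -
      have "norm (?D z) < e / 2" by (rule norm_less_if_tcoeff_le[OF D z Dle sD K[OF \<open>K \<le> n k\<close>]])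
      then have 1: "norm ((B ^^ n k) x z - a * powser (q k) z) < e / 2"
        by (simp add: fun_diff_def cscale_def)
      have "norm (a * powser (q k) z - f z) = norm a * norm (powser (q k) z - cscale (1 / a) f z)"
        using a by (simp add: norm_mult[symmetric] right_diff_distrib cscale_def)
      also have "\<dots> < norm a * (e / (2 * norm a))"
        using k(3)[OF z] a by (intro mult_strict_left_mono) auto
      also have "\<dots> = e / 2" using a by simp
      finally show ?thesis
        using 1 norm_triangle_ineq[of "(B ^^ n k) x z - a * powser (q k) z" "a * powser (q k) z - f z"] by simp
    qed
    have "1 \<le> n k" using p_less_n[of k] by linarith
    then show "\<exists>m\<ge>1. \<forall>z. norm z \<le> real r0 \<longrightarrow> norm ((B ^^ m) x z - f z) < e"
      using close r(2) by (intro exI[of _ "n k"]) auto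
  qed
qed

lemma block_space_hypercyclic_subspace: "hypercyclic_subspace B block_space"
  unfolding hypercyclic_subspace_def
  using subspace_coeff_relations closedin_coeff_relations block_space_infinite_dim block_space_hypercyclic by blast

end

section \<open>Recursive choice of the block positions and free indices\<close>

context entire_weighted_shift
begin

lemma hypercyclic_subspace_exists:
  assumes hyp: "hypercyclic B" and M: "1 \<le> M"
    and bounded: "\<And>L Q. \<exists>N\<ge>Q. \<forall>l\<le>L. norm (W N) \<le> M ^ N * norm (W (N - l))"
  shows "\<exists>M. hypercyclic_subspace B M"
proof -
  obtain C where C: "1 \<le> C" "\<And>n. 1 \<le> n \<Longrightarrow> norm (w n) \<le> C ^ n"
    using weights_exp_bounded by blast
  obtain i d :: "nat \<Rightarrow> nat" and q :: "nat \<Rightarrow> nat \<Rightarrow> complex" where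
    q_zero: "\<And>k j. d k < j \<Longrightarrow> q k j = 0" and
    q_dense: "\<And>i0 k0 f e r. \<lbrakk>f \<in> entire; 0 < e; 0 \<le> r\<rbrakk> \<Longrightarrow>
      \<exists>k\<ge>k0. i k = i0 \<and> (\<forall>z. norm z \<le> r \<longrightarrow> norm (powser (q k) z - f z) < e)"
    by (rule dense_labelled_polynomials) (rule that)
  \<comment> \<open>One step of the recursion: given \<open>p\<close>, first \<open>n\<close> is
    found by hypercyclicity, then \<open>p'\<close> by \<open>bounded\<close> with
    \<open>L = n\<close>.\<close>
  define \<Phi> where "\<Phi> k p n p' \<longleftrightarrow> p < n \<and> n + d k < p' \<and>
      (\<forall>j\<le>d k. norm (q k j) * ((2 * (real k + 1) * C ^ p) ^ (n + j) * norm (W j)) \<le> norm (W (n + j))) \<and>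
      (\<forall>l\<le>n. norm (W p') \<le> M ^ p' * norm (W (p' - l)))" for k p n p'
  have "\<exists>n p'. \<Phi> k p n p'" for k p
  proof -
    define s where "s = (\<Sum>j\<le>d k. norm (q k j))"
    have s: "0 < 1 + s" by (simp add: s_def sum_nonneg add_pos_nonneg)
    have qs: "norm (q k j) \<le> 1 + s" if "j \<le> d k" for j
      using member_le_sum[of j "{..d k}" "\<lambda>j. norm (q k j)"] that by (simp add: s_def)
    have "0 < 2 * (real k + 1) * C ^ p" using C(1) by simp
    \<comment> \<open>The maximum serves twice: it gives \<open>p < n\<close> and covers all
      \<open>j <= d k\<close>.\<close>
    then obtain n where n: "max (Suc p) (d k) \<le> n"
      "\<And>j. j \<le> max (Suc p) (d k) \<Longrightarrow>
        (2 * (real k + 1) * C ^ p) ^ (n + j) * norm (W j) \<le> 1 / (1 + s) * norm (W (n + j))"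
      using hypercyclic_imp_weights_large[OF hyp, of _ "1 / (1 + s)"] s by (metis divide_pos_pos zero_less_one)
    obtain p' where p': "Suc (n + d k) \<le> p'" "\<forall>l\<le>n. norm (W p') \<le> M ^ p' * norm (W (p' - l))"
      using bounded by blast
    have "norm (q k j) * ((2 * (real k + 1) * C ^ p) ^ (n + j) * norm (W j)) \<le> norm (W (n + j))"
      if j: "j \<le> d k" for j
    proof -
      have "norm (q k j) * ((2 * (real k + 1) * C ^ p) ^ (n + j) * norm (W j))
          \<le> (1 + s) * (1 / (1 + s) * norm (W (n + j)))"
        using s j C(1) by (intro mult_mono[OF qs[OF j] n(2)]) auto
      then show ?thesis using s by simp
    qed
    then have "\<Phi> k p n p'" using n(1) p' by (simp add: \<Phi>_def)
    then show ?thesis by blast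
  qed
  then obtain nf pf where step: "\<And>k p. \<Phi> k p (nf k p) (pf k p)" by metis
  define p where "p = rec_nat 0 pf"
  have p: "p 0 = 0" "\<And>k. p (Suc k) = pf k (p k)" by (simp_all add: p_def)
  have "\<Phi> k (p k) (nf k (p k)) (p (Suc k))" for k using step p(2) by simp
  then interpret block_construction w B C M i d p "\<lambda>k. nf k (p k)" q
    using C M q_zero q_dense p(1) by unfold_locales (auto simp: \<Phi>_def)
  show ?thesis using block_space_hypercyclic_subspace by blast
qed

end

section \<open>From the criterion to the growth of the weight products\<close>

theorem corollary4p7:
  fixes w :: "nat \<Rightarrow> complex"
    and B :: "(complex \<Rightarrow> complex) \<Rightarrow> (complex \<Rightarrow> complex)"
  assumes "weighted_shift w B" and "hypercyclic B"
  shows "(\<exists>M. hypercyclic_subspace B M) \<longleftrightarrow>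
    (\<exists>m::nat. m \<ge> 1 \<and>
      (SUP n\<in>{1::nat..}. INF k\<in>{0::nat..}.
        ereal ((\<Prod>\<nu>=1..n. cmod (w (\<nu> + k))) / real m ^ (n + k))) \<le> 1)"
proof -
  interpret entire_weighted_shift w B by unfold_locales (rule assms(1))
  obtain C where C: "1 \<le> C" "\<And>n. 1 \<le> n \<Longrightarrow> norm (w n) \<le> C ^ n"
    using weights_exp_bounded by blast
  define V where "V n = norm (W n)" for n
  have V0: "0 < V n" for n by (simp add: V_def)
  have V1: "V (Suc n) \<le> C ^ Suc n * V n" for n
    unfolding V_def W_Suc norm_mult by (intro mult_right_mono C(2)) auto
  let ?cond = "\<lambda>m::nat. (SUP n\<in>{1::nat..}. INF k\<in>{0::nat..}. ereal (V (n + k) / V k / real m ^ (n + k))) \<le> 1"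
  have eq: "(\<Prod>\<nu>=1..n. cmod (w (\<nu> + k))) = V (n + k) / V k" for n k
    by (simp only: prod_weights V_def)
  show ?thesis
    unfolding eq
  proof
    assume "\<exists>m::nat. m \<ge> 1 \<and> ?cond m"
    then obtain m :: nat where m: "1 \<le> m" "?cond m" by blast
    \<comment> \<open>An infimum at most 1 gives a quotient below 2 for some \<open>k\<close>, and
      \<open>2 <= 2 ^ (n + k)\<close> for \<open>n >= 1\<close>; doubling the base absorbs this
      factor.\<close>
    define M where "M = 2 * real m"
    have M: "1 < M" using m(1) by (simp add: M_def)
    have small: "\<exists>k. V (n + k) < M ^ (n + k) * V k" if n: "1 \<le> n" for n
    proof -
      have "(INF k\<in>{0::nat..}. ereal (V (n + k) / V k / real m ^ (n + k))) \<le> 1"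
        using m(2) n by (simp add: SUP_le_iff)
      also have "\<dots> < ereal 2" by (simp add: one_ereal_def)
      finally obtain k where "V (n + k) / V k / real m ^ (n + k) < 2"
        by (auto simp: INF_less_iff)
      then have "V (n + k) < 2 * real m ^ (n + k) * V k"
        using m(1) V0[of k] by (simp add: divide_less_eq mult_ac)
      also have "\<dots> \<le> M ^ (n + k) * V k"
      proof (intro mult_right_mono)
        have "(2::real) ^ 1 \<le> 2 ^ (n + k)" using n by (intro power_increasing) auto
        then show "2 * real m ^ (n + k) \<le> M ^ (n + k)"
          by (simp add: M_def power_mult_distrib mult_right_mono)
      qed (use V0[of k] in simp)
      finally show ?thesis by blast
    qed
    show "\<exists>M. hypercyclic_subspace B M"
    proof (rule hypercyclic_subspace_exists[OF assms(2) less_imp_le[OF M]])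
      fix L Q :: nat
      show "\<exists>N\<ge>Q. \<forall>l\<le>L. norm (W N) \<le> M ^ N * norm (W (N - l))"
      proof (rule ccontr)
        assume contra: "\<not> (\<exists>N\<ge>Q. \<forall>l\<le>L. norm (W N) \<le> M ^ N * norm (W (N - l)))"
        \<comment> \<open>Without such \<open>N\<close>, every large \<open>t\<close> is the top of
          a growing block of length at most \<open>L\<close>, where \<open>L <= t\<close> ensures
          \<open>l <= t\<close>. The resulting uniform growth contradicts
          \<open>small\<close>.\<close>
        have "\<exists>l\<ge>1. l \<le> L \<and> l \<le> t \<and> M ^ t * V (t - l) \<le> V t" if t: "max Q L \<le> t" for t
        proof -
          have "Q \<le> t" using t by simp
          then have "\<not> (\<forall>l\<le>L. norm (W t) \<le> M ^ t * norm (W (t - l)))" using contra by blast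
          then obtain l where l: "l \<le> L" "M ^ t * V (t - l) < V t"
            by (auto simp: V_def not_le)
          have "1 \<le> l"
          proof (rule ccontr)
            assume "\<not> 1 \<le> l"
            then have "l = 0" by simp
            then have "M ^ t * V t < V t" using l(2) by simp
            moreover have "1 * V t \<le> M ^ t * V t"
              using V0[of t] one_le_power[of M t] M by (intro mult_right_mono) auto
            ultimately show False by simp
          qed
          then show ?thesis using l t by (intro exI[of _ l]) auto
        qed
        then obtain n0 where n0: "\<And>n k. n0 \<le> n \<Longrightarrow> M ^ (n + k) * V k \<le> V (n + k)"
          using uniform_growth_from_blocks[OF V0 V1 C(1) M] by metis
        obtain k where "V (max 1 n0 + k) < M ^ (max 1 n0 + k) * V k" using small[of "max 1 n0"] by auto
        then show False using n0[of "max 1 n0" k] by simp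
      qed
    qed
  next
    assume "\<exists>M. hypercyclic_subspace B M"
    then obtain M where M: "hypercyclic_subspace B M" ..
    show "\<exists>m::nat. m \<ge> 1 \<and> ?cond m"
    proof (rule ccontr)
      assume none: "\<not> (\<exists>m::nat. m \<ge> 1 \<and> ?cond m)"
      have "\<exists>n0. \<forall>n\<ge>n0. \<forall>k. real m ^ (n + k) * norm (W k) \<le> norm (W (n + k))" if m: "2 \<le> m" for m :: nat
      proof -
        \<comment> \<open>A supremum above 1 provides one \<open>L\<close> with infimum above 1,
          hence blocks of exactly this length below every \<open>t >= L\<close>.\<close>
        have "\<not> ?cond m" using none m by auto
        then obtain L where L: "1 \<le> L"
          "1 < (INF k\<in>{0::nat..}. ereal (V (L + k) / V k / real m ^ (L + k)))"
          by (auto simp: SUP_le_iff not_le)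
        have big: "real m ^ (L + k) * V k \<le> V (L + k)" for k
        proof -
          have "1 < ereal (V (L + k) / V k / real m ^ (L + k))"
            using L(2) by (rule less_le_trans) (rule INF_lower, simp)
          then have "1 < V (L + k) / V k / real m ^ (L + k)" by (simp add: one_ereal_def)
          then show ?thesis using m V0[of k] by (simp add: less_divide_eq mult_ac)
        qed
        have "\<exists>l\<ge>1. l \<le> L \<and> l \<le> t \<and> real m ^ t * V (t - l) \<le> V t" if t: "L \<le> t" for t
          using big[of "t - L"] t L(1) by (intro exI[of _ L]) simp
        moreover have "1 < real m" using m by simp
        ultimately obtain n0 where "\<And>n k. n0 \<le> n \<Longrightarrow> real m ^ (n + k) * V k \<le> V (n + k)"
          using uniform_growth_from_blocks[OF V0 V1 C(1)] by metis
        then show ?thesis unfolding V_def by blast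
      qed
      then show False using no_hypercyclic_subspace M by blast
    qed
  qed
qed

end
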